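(* Assume $A$ is associative. For every $k\in\mathbb{N}$, the family $\mathscr{F}_k=\{\mathcal{T}_{\mathbf{k}}\}_{|\mathbf{k}|=k}$ (with $\mathbf{k}\in\mathbb{N}^{t_0+\tau}$) is a basis of the right $A$-module $U_k$. Namely, for every $P\in U_k$, \[P(x)=\sum_{|\mathbf{k}|=k}\mathcal{T}_{\mathbf{k}}(x)\,c_{\mathbf{k}},\qquad c_{\mathbf{k}}:=\frac{1}{\mathbf{k}!}\,\delta^{(0,\mathbf{k})}P(0),\] for all $x\in V$. In particular, $\delta^{(0,\mathbf{k})}\mathcal{T}_{\mathbf{k}}(0)=\mathbf{k}!$ and $\delta^{(0,\mathbf{k})}\mathcal{T}_{\mathbf{k}'}(0)=0$ when $\mathbf{k}\ne\mathbf{k}'$.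
   Context: $\mathbb{N}$ includes $0$. $A$ is a finite-dimensional alternative (unital) real $*$-algebra: a finite-dimensional real vector space with an $\mathbb{R}$-bilinear multiplication such that $x(xy)=x^2y$, $(xy)y=xy^2$ (automatic if $A$ is associative), and with an involutive real-linear antiautomorphism $x\mapsto x^c$; $\mathbb{R}$ is identified with $\mathbb{R}1$. Set $t(x)=x+x^c$, $n(x)=xx^c$, $\mathbb{S}_A=\{x\in A:t(x)=0,\ n(x)=1\}$, assumed nonempty. Let $Q_A=\bigcup_{J\in\mathbb{S}_A}(\mathbb{R}+J\mathbb{R})$. A hypercomplex subspace of $A$ is a real vector subspace $V$ with $\mathbb{R}\subsetneq V\subseteq Q_A$; a hypercomplex basis of $V$ is an ordered real basis $(v_0,\ldots,v_n)$ with $n\ge1$, $v_0=1$, $v_s\in\mathbb{S}_A$ and $v_sv_u=-v_uv_s$ for distinct $s,u\in\{1,\ldots,n\}$. Setting. $V$ is a hypercomplex subspace of $A$ with hypercomplex basis $\mathcal{B}=(v_0,\ldots,v_n)$, completed to a real basis $\mathcal{B}'$ of $A$; unit spheres below refer to the Euclidean norm making $\mathcal{B}'$ orthonormal. A domain is a nonempty connected open subset. Fix $\tau\in\{0,\ldots,n\}$ and a list of steps $T=(t_0,\ldots,t_\tau)\in\mathbb{N}^{\tau+1}$ with $0\le t_0<t_1<\cdots<t_\tau=n$. For $0\le\ell\le m\le n$, $\mathbb{R}_{\ell,m}=\mathrm{Span}(v_\ell,\ldots,v_m)$ and $\mathbb{S}_{\ell,m}$ is its unit sphere. The $T$-torus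 is $\mathbb{T}=\mathbb{S}_{t_0+1,t_1}\times\cdots\times\mathbb{S}_{t_{\tau-1}+1,t_\tau}$ if $\tau\ge1$. For $J=(J_1,\ldots,J_\tau)\in\mathbb{T}$, $\mathcal{B}_J=(v_0,v_1,\ldots,v_{t_0},J_1,\ldots,J_\tau)$ and $\mathbb{R}_J^{t_0+\tau+1}=\mathrm{Span}(\mathcal{B}_J)$, with elements written $x_0+v_1x_1+\cdots+v_{t_0}x_{t_0}+\beta_1J_1+\cdots+\beta_\tau J_\tau$. If $\tau=0$, "$J\in\mathbb{T}$" is read as $J=\emptyset$, with $\mathcal{B}_\emptyset=\mathcal{B}$ and $\mathbb{R}_\emptyset^{t_0+1}=V$. For $Y\subseteq V$ and $f:Y\to A$: $Y_J=Y\cap\mathbb{R}_J^{t_0+\tau+1}$ and $f_J=f|_{Y_J}$. A function $f:\Omega\to A$ on a domain $\Omega\subseteq V$ is $T$-regular if for every $J\in\mathbb{T}$ the restriction $f_J$ is $J$-monogenic, i.e. of class $\mathscr{C}^1$ on the open subset $\Omega_J$ of $\mathbb{R}_J^{t_0+\tau+1}$ with $(\partial_{x_0}+v_1\partial_{x_1}+\cdots+v_{t_0}\partial_{x_{t_0}}+J_1\partial_{\beta_1}+\cdots+J_\tau\partial_{\beta_\tau})f_J\equiv0$ (vacuous if $\Omega_J=\emptyset$). $\operatorname{Reg}_T(\Omega,A)$ is the class of such functions; it is a right $A$-module when $A$ is associative. $U_k$ is the right $A$-submodule of those $f\in\operatorname{Reg}_T(V,A)$ such that $f(x_0v_0+\cdots+x_nv_n)$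 is a $k$-homogeneous polynomial map in the real variables $x_0,\ldots,x_n$. Multi-indices: for $\mathbf{k}=(k_1,\ldots,k_{t_0+\tau})$, $|\mathbf{k}|=\sum_sk_s$, $\mathbf{k}!=\prod_sk_s!$; $\epsilon_s$ is the $s$-th standard unit vector of $\mathbb{N}^{t_0+\tau}$. Adapted derivatives. For $\mathbf{h}=(h_0,\ldots,h_{t_0+\tau})\in\mathbb{N}^{t_0+\tau+1}$ and $f$ $T$-regular on $\Omega$, $\delta^{\mathbf{h}}f:\Omega\to A$ is the function with \[(\delta^{\mathbf{h}}f)_J=(J_\tau^{h_{t_0+\tau}}\cdots J_1^{h_{t_0+1}})^{-1}\,\partial_{x_0}^{h_0}\cdots\partial_{x_{t_0}}^{h_{t_0}}\partial_{\beta_1}^{h_{t_0+1}}\cdots\partial_{\beta_\tau}^{h_{t_0+\tau}}f_J\] in $\Omega_J$ for all $J\in\mathbb{T}$ (this is well defined); for $\tau=0$, $\delta^{\mathbf{h}}=\partial_{x_0}^{h_0}\cdots\partial_{x_n}^{h_n}$. Polynomials $\mathcal{T}_{\mathbf{k}}$. For $x=\sum_{\ell=0}^nx_\ell v_\ell\in V$ and $1\le h\le\tau$, put $x^h=\sum_{\ell=t_{h-1}+1}^{t_h}x_\ell v_\ell$. Define $\mathcal{T}_{\mathbf{k}}:V\to A$ by $\mathcal{T}_{\mathbf{k}}\equiv0$ if $\mathbf{k}\in\mathbb{Z}^{t_0+\tau}\setminus\mathbb{N}^{t_0+\tau}$, $\mathcal{T}_{(0,\ldots,0)}\equiv1$,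 and recursively for other $\mathbf{k}\in\mathbb{N}^{t_0+\tau}$ \[|\mathbf{k}|\,\mathcal{T}_{\mathbf{k}}(x)=\sum_{s=1}^{t_0}k_s\,\mathcal{T}_{\mathbf{k}-\epsilon_s}(x)\,(x_s-(-1)^ax_0v_s)+\sum_{s=t_0+1}^{t_0+\tau}(-1)^{b_s}k_s\,\mathcal{T}_{\mathbf{k}-\epsilon_s}(x)\,(x_0+(-1)^{a_s}x^{s-t_0}),\] with $a=\sum_{u=t_0+1}^{t_0+\tau}k_u$, $a_s=a-k_s$, $b_s=\sum_{u=s+1}^{t_0+\tau}k_u$. *)

theory Defs
  imports "HOL-Analysis.Analysis"
begin

text \<open>
  The algebra is a type of sort \<open>{real_algebra_1, euclidean_space}\<close>: a unital associative real algebra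
  of finite dimension. The Euclidean structure is not assumed compatible with the multiplication or
  with any chosen basis; it only supplies the (unique) vector space topology, so every
  finite-dimensional unital associative real algebra is covered.

  Functions \<open>Y \<rightarrow> A\<close> with \<open>Y \<subseteq> V\<close> are elements of \<open>extensional Y\<close>, so that two of them are equal
  iff they agree on \<open>Y\<close>.
\<close>

section \<open>Hypercomplex subspaces of a real *-algebra\<close>

definition star_involution :: "('a::real_algebra_1 \<Rightarrow> 'a) \<Rightarrow> bool" where
  "star_involution cj \<longleftrightarrow>
     linear cj \<and> (\<forall>x. cj (cj x) = x) \<and> (\<forall>x y. cj (x * y) = cj y * cj x)"

definition star_trace :: "('a::real_algebra_1 \<Rightarrow> 'a) \<Rightarrow> 'a \<Rightarrow> 'a" where
  "star_trace cj x = x + cj x"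

definition star_norm :: "('a::real_algebra_1 \<Rightarrow> 'a) \<Rightarrow> 'a \<Rightarrow> 'a" where
  "star_norm cj x = x * cj x"

definition imag_units :: "('a::real_algebra_1 \<Rightarrow> 'a) \<Rightarrow> 'a set" where
  "imag_units cj = {x. star_trace cj x = 0 \<and> star_norm cj x = 1}"

definition quadratic_cone :: "('a::real_algebra_1 \<Rightarrow> 'a) \<Rightarrow> 'a set" where
  "quadratic_cone cj = (\<Union>J\<in>imag_units cj. {of_real a + J * of_real b | a b. True})"

definition hypercomplex_subspace :: "('a::real_algebra_1 \<Rightarrow> 'a) \<Rightarrow> 'a set \<Rightarrow> bool" where
  "hypercomplex_subspace cj V \<longleftrightarrow> subspace V \<and> \<real> \<subset> V \<and> V \<subseteq> quadratic_cone cj"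

definition hypercomplex_basis ::
    "('a::real_algebra_1 \<Rightarrow> 'a) \<Rightarrow> 'a set \<Rightarrow> nat \<Rightarrow> (nat \<Rightarrow> 'a) \<Rightarrow> bool" where
  "hypercomplex_basis cj V n v \<longleftrightarrow>
     n \<ge> 1 \<and> inj_on v {0..n} \<and> independent (v ` {0..n}) \<and> span (v ` {0..n}) = V \<and>
     v 0 = 1 \<and> (\<forall>s\<in>{1..n}. v s \<in> imag_units cj) \<and>
     (\<forall>s\<in>{1..n}. \<forall>u\<in>{1..n}. s \<noteq> u \<longrightarrow> v s * v u = - (v u * v s))"

definition completes_basis :: "'a::real_vector set \<Rightarrow> nat \<Rightarrow> (nat \<Rightarrow> 'a) \<Rightarrow> bool" where
  "completes_basis B n v \<longleftrightarrow> v ` {0..n} \<subseteq> B \<and> independent B \<and> span B = UNIV"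

text \<open>The Euclidean norm for which the (finite) basis \<open>B\<close> of the whole algebra is orthonormal.\<close>

definition basis_norm :: "'a::real_vector set \<Rightarrow> 'a \<Rightarrow> real" where
  "basis_norm B x = L2_set (representation B x) B"

section \<open>The T-torus and T-regular functions\<close>

text \<open>\<open>T = (t 0, \<dots>, t \<tau>)\<close>\<close>

definition step_list :: "nat \<Rightarrow> nat \<Rightarrow> (nat \<Rightarrow> nat) \<Rightarrow> bool" where
  "step_list n \<tau> t \<longleftrightarrow> \<tau> \<le> n \<and> strict_mono_on {0..\<tau>} t \<and> t \<tau> = n"

definition unit_sphere :: "'a::real_vector set \<Rightarrow> (nat \<Rightarrow> 'a) \<Rightarrow> nat \<Rightarrow> nat \<Rightarrow> 'a set" where
  "unit_sphere B v l m = {x \<in> span (v ` {l..m}). basis_norm B x = 1}"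

text \<open>For \<open>\<tau> = 0\<close> the torus has exactly one element, the empty tuple.\<close>

definition T_torus ::
    "'a::real_vector set \<Rightarrow> (nat \<Rightarrow> 'a) \<Rightarrow> (nat \<Rightarrow> nat) \<Rightarrow> nat \<Rightarrow> (nat \<Rightarrow> 'a) set" where
  "T_torus B v t \<tau> = (\<Pi>\<^sub>E h\<in>{1..\<tau>}. unit_sphere B v (t (h - 1) + 1) (t h))"

text \<open>\<open>adapted_basis v t J\<close> enumerates \<open>(v 0, \<dots>, v (t 0), J 1, \<dots>, J \<tau>)\<close> by \<open>0, \<dots>, t 0 + \<tau>\<close>.\<close>

definition adapted_basis :: "(nat \<Rightarrow> 'a) \<Rightarrow> (nat \<Rightarrow> nat) \<Rightarrow> (nat \<Rightarrow> 'a) \<Rightarrow> nat \<Rightarrow> 'a" where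
  "adapted_basis v t J s = (if s \<le> t 0 then v s else J (s - t 0))"

definition adapted_space ::
    "(nat \<Rightarrow> 'a::real_vector) \<Rightarrow> (nat \<Rightarrow> nat) \<Rightarrow> nat \<Rightarrow> (nat \<Rightarrow> 'a) \<Rightarrow> 'a set" where
  "adapted_space v t \<tau> J = span (adapted_basis v t J ` {0..t 0 + \<tau>})"

text \<open>
  Partial derivative along a basis vector \<open>w\<close>. When \<open>w\<close> lies in a subspace \<open>W\<close> and \<open>x\<close> in a relatively
  open subset of \<open>W\<close> on which \<open>f\<close> is defined, only values of \<open>f\<close> in that subset matter.
\<close>

definition partial_deriv :: "'a::real_vector \<Rightarrow> ('a \<Rightarrow> 'b::real_normed_vector) \<Rightarrow> 'a \<Rightarrow> 'b" where
  "partial_deriv w f x = vector_derivative (\<lambda>r. f (x + r *\<^sub>R w)) (at 0)"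

text \<open>
  \<open>C1_along w m U f\<close>: \<open>f\<close> is of class \<open>C\<^sup>1\<close> on the relatively open subset \<open>U\<close> of the span of the
  basis \<open>(w 0, \<dots>, w m)\<close>, that is, the partial derivatives in the coordinates with respect to
  this basis exist and are continuous on \<open>U\<close>.
\<close>

definition C1_along ::
    "(nat \<Rightarrow> 'a::real_normed_vector) \<Rightarrow> nat \<Rightarrow> 'a set \<Rightarrow> ('a \<Rightarrow> 'b::real_normed_vector) \<Rightarrow> bool" where
  "C1_along w m U f \<longleftrightarrow>
     (\<forall>s\<in>{0..m}. (\<forall>x\<in>U. (\<lambda>r. f (x + r *\<^sub>R w s)) differentiable (at 0)) \<and>
                 continuous_on U (partial_deriv (w s) f))"

definition J_monogenic ::
    "(nat \<Rightarrow> 'a::{real_algebra_1, euclidean_space}) \<Rightarrow> nat \<Rightarrow> 'a set \<Rightarrow> ('a \<Rightarrow> 'a) \<Rightarrow> bool" where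
  "J_monogenic w m U f \<longleftrightarrow>
     C1_along w m U f \<and> (\<forall>x\<in>U. (\<Sum>s=0..m. w s * partial_deriv (w s) f x) = 0)"

text \<open>The set \<open>\<Omega>\<close> is meant to be a domain in the span of \<open>v 0, \<dots>, v n\<close>.\<close>

definition T_regular ::
    "'a::{real_algebra_1, euclidean_space} set \<Rightarrow> (nat \<Rightarrow> 'a) \<Rightarrow> (nat \<Rightarrow> nat) \<Rightarrow> nat \<Rightarrow> 'a set
      \<Rightarrow> ('a \<Rightarrow> 'a) set" where
  "T_regular B v t \<tau> \<Omega> =
     {f \<in> extensional \<Omega>. \<forall>J\<in>T_torus B v t \<tau>.
        J_monogenic (adapted_basis v t J) (t 0 + \<tau>) (\<Omega> \<inter> adapted_space v t \<tau> J) f}"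

section \<open>Multi-indices and homogeneous polynomial maps\<close>

text \<open>Multi-indices on \<open>I\<close> are functions vanishing outside \<open>I\<close>.\<close>

definition multi_indices :: "nat set \<Rightarrow> (nat \<Rightarrow> nat) set" where
  "multi_indices I = {\<kappa>. \<forall>s. s \<notin> I \<longrightarrow> \<kappa> s = 0}"

definition multi_indices_of_degree :: "nat set \<Rightarrow> nat \<Rightarrow> (nat \<Rightarrow> nat) set" where
  "multi_indices_of_degree I k = {\<kappa> \<in> multi_indices I. (\<Sum>s\<in>I. \<kappa> s) = k}"

definition multi_fact :: "nat set \<Rightarrow> (nat \<Rightarrow> nat) \<Rightarrow> nat" where
  "multi_fact I \<kappa> = (\<Prod>s\<in>I. fact (\<kappa> s))"

definition homogeneous_polynomial_map ::
    "nat \<Rightarrow> (nat \<Rightarrow> 'a::real_vector) \<Rightarrow> nat \<Rightarrow> ('a \<Rightarrow> 'a) \<Rightarrow> bool" where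
  "homogeneous_polynomial_map n v k f \<longleftrightarrow>
     (\<exists>c. \<forall>x :: nat \<Rightarrow> real. f (\<Sum>i=0..n. x i *\<^sub>R v i) =
        (\<Sum>\<alpha>\<in>multi_indices_of_degree {0..n} k. (\<Prod>i=0..n. x i ^ \<alpha> i) *\<^sub>R c \<alpha>))"

definition U_module ::
    "'a::{real_algebra_1, euclidean_space} set \<Rightarrow> nat \<Rightarrow> (nat \<Rightarrow> 'a) \<Rightarrow> (nat \<Rightarrow> nat) \<Rightarrow> nat \<Rightarrow> nat
      \<Rightarrow> ('a \<Rightarrow> 'a) set" where
  "U_module B n v t \<tau> k =
     {f \<in> T_regular B v t \<tau> (span (v ` {0..n})). homogeneous_polynomial_map n v k f}"

text \<open>
  A finite family \<open>b\<close>, indexed by \<open>I\<close>, of functions \<open>X \<rightarrow> A\<close> is a basis of a set \<open>M\<close> of such functions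
  if \<open>M\<close> is its right \<open>A\<close>-linear span and the family is right \<open>A\<close>-linearly independent.
\<close>

definition right_module_basis ::
    "'x set \<Rightarrow> 'i set \<Rightarrow> ('i \<Rightarrow> 'x \<Rightarrow> 'a::ring_1) \<Rightarrow> ('x \<Rightarrow> 'a) set \<Rightarrow> bool" where
  "right_module_basis X I b M \<longleftrightarrow>
     finite I \<and> (\<forall>i\<in>I. b i \<in> extensional X) \<and>
     M = range (\<lambda>c. \<lambda>x\<in>X. \<Sum>i\<in>I. b i x * c i) \<and>
     (\<forall>c. (\<forall>x\<in>X. (\<Sum>i\<in>I. b i x * c i) = 0) \<longrightarrow> (\<forall>i\<in>I. c i = 0))"

section \<open>Adapted derivatives\<close>

definition mult_inverse :: "'a::ring_1 \<Rightarrow> 'a" where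
  "mult_inverse a = (THE b. a * b = 1 \<and> b * a = 1)"

definition adapted_deriv_J ::
    "(nat \<Rightarrow> 'a::{real_algebra_1, euclidean_space}) \<Rightarrow> (nat \<Rightarrow> nat) \<Rightarrow> nat \<Rightarrow> (nat \<Rightarrow> 'a)
      \<Rightarrow> (nat \<Rightarrow> nat) \<Rightarrow> ('a \<Rightarrow> 'a) \<Rightarrow> 'a \<Rightarrow> 'a" where
  "adapted_deriv_J v t \<tau> J h f x =
     mult_inverse (prod_list (map (\<lambda>i. J i ^ h (t 0 + i)) (rev [1..<Suc \<tau>]))) *
     foldr (\<lambda>s. partial_deriv (adapted_basis v t J s) ^^ h s) [0..<Suc (t 0 + \<tau>)] f x"

text \<open>
  The value at \<open>x\<close> is the common value of the right-hand sides over all \<open>J\<close> with \<open>x \<in> \<Omega>\<^sub>J\<close>; the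
  description is proper when \<open>f\<close> is \<open>T\<close>-regular on \<open>\<Omega>\<close>.
\<close>

definition adapted_deriv ::
    "'a::{real_algebra_1, euclidean_space} set \<Rightarrow> (nat \<Rightarrow> 'a) \<Rightarrow> (nat \<Rightarrow> nat) \<Rightarrow> nat \<Rightarrow> 'a set
      \<Rightarrow> (nat \<Rightarrow> nat) \<Rightarrow> ('a \<Rightarrow> 'a) \<Rightarrow> 'a \<Rightarrow> 'a" where
  "adapted_deriv B v t \<tau> \<Omega> h f =
     (\<lambda>x\<in>\<Omega>. THE y. \<forall>J\<in>T_torus B v t \<tau>.
        x \<in> \<Omega> \<inter> adapted_space v t \<tau> J \<longrightarrow> y = adapted_deriv_J v t \<tau> J h f x)"

section \<open>The polynomials\<close>

definition coord :: "nat \<Rightarrow> (nat \<Rightarrow> 'a::real_vector) \<Rightarrow> 'a \<Rightarrow> nat \<Rightarrow> real" where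
  "coord n v x s = representation (v ` {0..n}) x (v s)"

definition block_part ::
    "nat \<Rightarrow> (nat \<Rightarrow> 'a::real_vector) \<Rightarrow> (nat \<Rightarrow> nat) \<Rightarrow> 'a \<Rightarrow> nat \<Rightarrow> 'a" where
  "block_part n v t x h = (\<Sum>l=t (h - 1) + 1..t h. coord n v x l *\<^sub>R v l)"

text \<open>
  The guards \<open>\<kappa> s = 0\<close> implement the convention that the polynomials with a negative index entry vanish.
\<close>

function T_poly_rec ::
    "nat \<Rightarrow> (nat \<Rightarrow> 'a::real_algebra_1) \<Rightarrow> (nat \<Rightarrow> nat) \<Rightarrow> nat \<Rightarrow> (nat \<Rightarrow> nat) \<Rightarrow> 'a \<Rightarrow> 'a" where
  "T_poly_rec n v t \<tau> \<kappa> x =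
     (if (\<Sum>s=1..t 0 + \<tau>. \<kappa> s) = 0 then 1 else
      (1 / real (\<Sum>s=1..t 0 + \<tau>. \<kappa> s)) *\<^sub>R
      ((\<Sum>s=1..t 0.
          real (\<kappa> s) *\<^sub>R
          ((if \<kappa> s = 0 then 0 else T_poly_rec n v t \<tau> (\<kappa>(s := \<kappa> s - 1)) x) *
           (of_real (coord n v x s) -
              ((-1) ^ (\<Sum>u=t 0 + 1..t 0 + \<tau>. \<kappa> u) * coord n v x 0) *\<^sub>R v s))) +
       (\<Sum>s=t 0 + 1..t 0 + \<tau>.
          ((-1) ^ (\<Sum>u=s + 1..t 0 + \<tau>. \<kappa> u) * real (\<kappa> s)) *\<^sub>R
          ((if \<kappa> s = 0 then 0 else T_poly_rec n v t \<tau> (\<kappa>(s := \<kappa> s - 1)) x) *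
           (of_real (coord n v x 0) +
              (-1) ^ ((\<Sum>u=t 0 + 1..t 0 + \<tau>. \<kappa> u) - \<kappa> s) *\<^sub>R block_part n v t x (s - t 0))))))"
  by pat_completeness auto

lemma sum_decrement_less:
  fixes \<kappa> :: "nat \<Rightarrow> nat"
  assumes "finite I" "s \<in> I" "\<kappa> s \<noteq> 0"
  shows "sum (\<kappa>(s := \<kappa> s - 1)) I < sum \<kappa> I"
proof (rule sum_strict_mono_ex1)
  show "\<forall>x\<in>I. (\<kappa>(s := \<kappa> s - 1)) x \<le> \<kappa> x" by simp
  show "\<exists>x\<in>I. (\<kappa>(s := \<kappa> s - 1)) x < \<kappa> x"
    using assms by (intro bexI[of _ s]) auto
qed (use assms in simp)

termination
proof (relation "Wellfounded.measure (\<lambda>(n, v, t, \<tau>, \<kappa>, x). \<Sum>s=1..t 0 + \<tau>. \<kappa> s)", goal_cases)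
  case 1
  show ?case by simp
next
  case (2 n v t \<tau> \<kappa> x s)
  then show ?case
    using sum_decrement_less[of "{1..t 0 + \<tau>}" s \<kappa>] by simp
next
  case (3 n v t \<tau> \<kappa> x s)
  then show ?case
    using sum_decrement_less[of "{1..t 0 + \<tau>}" s \<kappa>] by simp
qed

declare T_poly_rec.simps [simp del]

definition T_poly ::
    "nat \<Rightarrow> (nat \<Rightarrow> 'a::real_algebra_1) \<Rightarrow> (nat \<Rightarrow> nat) \<Rightarrow> nat \<Rightarrow> (nat \<Rightarrow> nat) \<Rightarrow> 'a \<Rightarrow> 'a" where
  "T_poly n v t \<tau> \<kappa> = restrict (T_poly_rec n v t \<tau> \<kappa>) (span (v ` {0..n}))"

end

theory Submission
  imports Defs
begin

text \<open>
  Every \<open>J\<close> in the torus cuts out of \<open>V\<close> the slice spanned by \<open>1, v 1, \<dots>, v (t 0), J 1, \<dots>, J \<tau>\<close>. On a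
  slice, T-regularity is the equation \<open>\<Sum>s w s * \<partial>s f = 0\<close> of a single Cauchy-Riemann operator, for which
  the Fueter polynomials \<open>F \<kappa>\<close> (the products of the variables \<open>x s - x 0 * w s\<close>, averaged over all
  orders of the factors and divided by the factorial of the multi-index) play the role of the monomials
  \<open>z ^ k / k!\<close>: they are monogenic, \<open>\<partial>s F \<kappa> = F (\<kappa> - \<epsilon> s)\<close> for \<open>s \<ge> 1\<close>, and on the hyperplane \<open>x 0 = 0\<close> they are
  \<open>x ^ \<kappa> / \<kappa>!\<close>. A homogeneous monogenic polynomial that vanishes on a coordinate hyperplane is zero, because
  the equation expresses the normal derivative by tangential ones; hence it is a combination of Fueter
  polynomials (\<open>fueter_expansion\<close>).

  The polynomials of the theorem are the Fueter polynomials of all slices glued together: on the slice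
  of \<open>J\<close>, the one with index \<open>\<kappa>\<close> is \<open>\<kappa>! F \<kappa>\<close> times \<open>J \<tau> ^ \<kappa> (t 0 + \<tau>) * \<dots> * J 1 ^ \<kappa> (t 0 + 1)\<close>, and the
  signs in the recursion come from moving one unit through that product (\<open>T_poly_rec_slice\<close>). So their
  right combinations are T-regular, and since the adapted derivative removes precisely this product, it
  reads off the coefficient of each term at the origin, with the same answer for all \<open>J\<close>
  (\<open>adapted_deriv_combination\<close>). This gives independence, the formula for the coefficients and the
  orthogonality relations as soon as the family is known to generate.

  For generation, expand \<open>P\<close> on one slice into Fueter polynomials and subtract the corresponding
  combination. The difference is regular and vanishes on that slice, and it remains to see that it
  vanishes everywhere. The slices of two elements of the torus that differ only in the component \<open>h\<close>
  share the coordinate hyperplane on which the coordinate of \<open>J h\<close> is zero, so vanishing on the first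
  slice implies vanishing on the second (\<open>eq_0_on_adjacent_slice\<close>). Changing the components one after the
  other reaches every slice, and the slices cover \<open>V\<close>.
\<close>

section \<open>Homogeneous polynomials in real coordinates\<close>

definition pd :: "nat \<Rightarrow> ((nat \<Rightarrow> real) \<Rightarrow> 'a::real_normed_vector) \<Rightarrow> (nat \<Rightarrow> real) \<Rightarrow> 'a" where
  "pd s F x = vector_derivative (\<lambda>r. F (x(s := x s + r))) (at 0)"

text \<open>  Points are functions on all natural numbers of which only the coordinates \<open>0, \<dots>, m\<close> matter, so that the
  number of variables is a term and slices of any dimension can be treated alike. The zero polynomial
  belongs to every degree; then \<open>\<partial>s\<close> lowers degree \<open>k\<close> to \<open>k - 1\<close> also for \<open>k = 0\<close>.\<close>

inductive hom_poly :: "nat \<Rightarrow> nat \<Rightarrow> ((nat \<Rightarrow> real) \<Rightarrow> 'a::real_normed_vector) \<Rightarrow> bool" for m where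
  const: "hom_poly m 0 (\<lambda>x. c)"
| zero: "hom_poly m k (\<lambda>x. 0)"
| mult: "hom_poly m k F \<Longrightarrow> i \<le> m \<Longrightarrow> hom_poly m (Suc k) (\<lambda>x. x i *\<^sub>R F x)"
| add: "hom_poly m k F \<Longrightarrow> hom_poly m k G \<Longrightarrow> hom_poly m k (\<lambda>x. F x + G x)"

text \<open>  The last conjunct serves the product rule for \<open>x i *\<^sub>R F x\<close> with \<open>F\<close> constant: the term \<open>x i *\<^sub>R G x\<close> has
  degree \<open>1\<close> by construction and belongs to degree \<open>0\<close> only because it is zero.\<close>

lemma hom_poly_derivative_exists:
  "hom_poly m k F \<Longrightarrow>
    \<exists>G. (\<forall>x. ((\<lambda>r. F (x(s := x s + r))) has_vector_derivative G x) (at 0)) \<and>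
        hom_poly m (k - 1) G \<and> (k = 0 \<longrightarrow> G = (\<lambda>x. 0))"
proof (induction rule: hom_poly.induct)
  case (const c)
  then show ?case by (auto intro: hom_poly.zero)
next
  case (zero k)
  then show ?case by (auto intro!: exI[of _ "\<lambda>x. 0"] hom_poly.zero)
next
  case (mult k F i)
  from mult.IH obtain G where "\<forall>x. ((\<lambda>r. F (x(s := x s + r))) has_vector_derivative G x) (at 0)"
    "hom_poly m (k - 1) G" "k = 0 \<longrightarrow> G = (\<lambda>x. 0)" by (elim exE conjE)
  then have G: "\<And>x. ((\<lambda>r. F (x(s := x s + r))) has_vector_derivative G x) (at 0)"
    "hom_poly m (k - 1) G" "k = 0 \<Longrightarrow> G = (\<lambda>x. 0)" by auto
  define H where "H = (\<lambda>x. (if i = s then F x else 0) + x i *\<^sub>R G x)"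
  have "((\<lambda>r. (\<lambda>x. x i *\<^sub>R F x) (x(s := x s + r))) has_vector_derivative H x) (at 0)" for x
  proof -
    have "((\<lambda>r. (x(s := x s + r)) i) has_real_derivative (if i = s then 1 else 0)) (at 0)"
      by (auto intro!: derivative_eq_intros)
    from has_vector_derivative_scaleR[OF this G(1)[of x]] show ?thesis
      by (auto simp: H_def add.commute)
  qed
  moreover have "hom_poly m k (\<lambda>x. x i *\<^sub>R G x)"
  proof (cases k)
    case 0
    then show ?thesis using G(3) by (simp add: hom_poly.zero)
  next
    case (Suc l)
    then show ?thesis using G(2) mult by (auto intro: hom_poly.mult)
  qed
  then have "hom_poly m k H" unfolding H_def
    using mult by (cases "i = s") (auto intro: hom_poly.add)
  ultimately have "(\<forall>x. ((\<lambda>r. (\<lambda>x. x i *\<^sub>R F x) (x(s := x s + r))) has_vector_derivative H x) (at 0)) \<and>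
      hom_poly m (Suc k - 1) H \<and> (Suc k = 0 \<longrightarrow> H = (\<lambda>x. 0))"
    unfolding diff_Suc_1 by blast
  then show ?case by (intro exI[of _ H])
next
  case (add k F G)
  from add.IH obtain F' G' where FG:
    "\<forall>x. ((\<lambda>r. F (x(s := x s + r))) has_vector_derivative F' x) (at 0)"
    "hom_poly m (k - 1) F'" "k = 0 \<longrightarrow> F' = (\<lambda>x. 0)"
    "\<forall>x. ((\<lambda>r. G (x(s := x s + r))) has_vector_derivative G' x) (at 0)"
    "hom_poly m (k - 1) G'" "k = 0 \<longrightarrow> G' = (\<lambda>x. 0)" by (elim exE conjE)
  have "((\<lambda>r. F (x(s := x s + r)) + G (x(s := x s + r))) has_vector_derivative F' x + G' x) (at 0)" for x
    by (intro has_vector_derivative_add FG(1)[rule_format] FG(4)[rule_format])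
  moreover have "hom_poly m (k - 1) (\<lambda>x. F' x + G' x)"
    by (intro hom_poly.add FG)
  moreover have "k = 0 \<longrightarrow> (\<lambda>x. F' x + G' x) = (\<lambda>x. 0)"
    using FG(3,6) by simp
  ultimately show ?case
    by (intro exI[of _ "\<lambda>x. F' x + G' x"] conjI allI)
qed

lemma hom_poly_has_pd:
  assumes "hom_poly m k F"
  shows "((\<lambda>r. F (x(s := x s + r))) has_vector_derivative pd s F x) (at 0)"
  using hom_poly_derivative_exists[OF assms, of s]
  by (metis pd_def vector_derivative_at)

lemma pd_eqI:
  assumes "\<And>x. ((\<lambda>r. F (x(s := x s + r))) has_vector_derivative G x) (at 0)"
  shows "pd s F = G"
  unfolding pd_def using assms by (intro ext vector_derivative_at)

lemma hom_poly_pd: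
  assumes "hom_poly m k F"
  shows "hom_poly m (k - 1) (pd s F)"
  using hom_poly_derivative_exists[OF assms, of s] pd_eqI by metis

lemma pd_hom_poly_0:
  assumes "hom_poly m 0 F"
  shows "pd s F = (\<lambda>x. 0)"
  using hom_poly_derivative_exists[OF assms, of s] pd_eqI by metis

lemma pd_const: "pd s (\<lambda>x. c) = (\<lambda>x. 0)"
  by (intro pd_eqI) auto

lemma pd_add:
  assumes "hom_poly m k F" "hom_poly m l G"
  shows "pd s (\<lambda>x. F x + G x) = (\<lambda>x. pd s F x + pd s G x)"
  by (intro pd_eqI has_vector_derivative_add hom_poly_has_pd[OF assms(1)] hom_poly_has_pd[OF assms(2)])

lemma pd_sum:
  assumes "\<And>i. i \<in> I \<Longrightarrow> hom_poly m (k i) (F i)"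
  shows "pd s (\<lambda>x. \<Sum>i\<in>I. F i x) = (\<lambda>x. \<Sum>i\<in>I. pd s (F i) x)"
  by (intro pd_eqI has_vector_derivative_sum hom_poly_has_pd[OF assms])

lemma pd_linear:
  assumes "hom_poly m k F" "bounded_linear L"
  shows "pd s (\<lambda>x. L (F x)) = (\<lambda>x. L (pd s F x))"
  by (intro pd_eqI bounded_linear.has_vector_derivative[OF assms(2)] hom_poly_has_pd[OF assms(1)])

lemma pd_mult:
  assumes "hom_poly m k F"
  shows "pd s (\<lambda>x. x i *\<^sub>R F x) = (\<lambda>x. (if i = s then F x else 0) + x i *\<^sub>R pd s F x)"
proof (intro pd_eqI)
  fix x :: "nat \<Rightarrow> real"
  have "((\<lambda>r. (x(s := x s + r)) i) has_real_derivative (if i = s then 1 else 0)) (at 0)"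
    by (auto intro!: derivative_eq_intros)
  from has_vector_derivative_scaleR[OF this hom_poly_has_pd[OF assms(1), of x s]]
  show "((\<lambda>r. (x(s := x s + r)) i *\<^sub>R F (x(s := x s + r))) has_vector_derivative
    (if i = s then F x else 0) + x i *\<^sub>R pd s F x) (at 0)"
    by (auto simp: add.commute)
qed

lemma hom_poly_sum:
  assumes "\<And>i. i \<in> I \<Longrightarrow> hom_poly m k (F i)"
  shows "hom_poly m k (\<lambda>x. \<Sum>i\<in>I. F i x)"
  using assms by (induction I rule: infinite_finite_induct) (auto intro: hom_poly.intros)

lemma hom_poly_linear:
  assumes "hom_poly m k F" "linear L"
  shows "hom_poly m k (\<lambda>x. L (F x))"
  using assms(1)
  by (induction rule: hom_poly.induct)
     (auto simp: linear_add[OF assms(2)] linear_0[OF assms(2)] linear_scale[OF assms(2)]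
       intro: hom_poly.intros)

lemma hom_poly_diff:
  assumes "hom_poly m k F" "hom_poly m k G"
  shows "hom_poly m k (\<lambda>x. F x - G x)"
  using hom_poly.add[OF assms(1) hom_poly_linear[OF assms(2) linear_scaleR[of "-1"]]] by simp

text \<open>  By the product rule, the second derivative of \<open>x i *\<^sub>R F x\<close> is symmetric as soon as that of \<open>F\<close> is, so the
  symmetry is inherited along the construction of the polynomial.\<close>

lemma pd_commute:
  "hom_poly m k F \<Longrightarrow> pd s (pd u F) = pd u (pd s F)"
proof (induction rule: hom_poly.induct)
  case (mult k F i)
  note P = hom_poly_pd[OF mult.hyps(1)]
  have "pd a (pd b (\<lambda>x. x i *\<^sub>R F x)) =
    (\<lambda>x. (if i = b then pd a F x else 0) + ((if i = a then pd b F x else 0) + x i *\<^sub>R pd a (pd b F) x))" for a b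
  proof -
    have 1: "hom_poly m (Suc (k - 1)) (\<lambda>x. x i *\<^sub>R pd b F x)"
      using P mult by (intro hom_poly.mult)
    have "pd a (\<lambda>x. (if i = b then F x else 0)) = (\<lambda>x. if i = b then pd a F x else 0)"
      by (auto simp: pd_const)
    moreover have "hom_poly m k (\<lambda>x. if i = b then F x else 0)"
      using mult.hyps by (cases "i = b") (auto intro: hom_poly.zero)
    ultimately show ?thesis
      unfolding pd_mult[OF mult.hyps(1)]
      by (simp add: pd_add[OF _ 1] pd_mult[OF P])
  qed
  then show ?case using mult by (auto simp: fun_eq_iff)
next
  case (add k F G)
  then show ?case
    by (simp add: pd_add[OF add.hyps(1,2)] pd_add[OF hom_poly_pd hom_poly_pd, OF add.hyps(1,2)])
qed (simp_all add: pd_const)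

lemma hom_poly_euler:
  "hom_poly m k F \<Longrightarrow> (\<Sum>s=0..m. x s *\<^sub>R pd s F x) = real k *\<^sub>R F x"
proof (induction rule: hom_poly.induct)
  case (mult k F i)
  have "(\<Sum>s=0..m. x s *\<^sub>R pd s (\<lambda>x. x i *\<^sub>R F x) x)
     = (\<Sum>s=0..m. (if i = s then x s *\<^sub>R F x else 0) + x i *\<^sub>R (x s *\<^sub>R pd s F x))"
    by (intro sum.cong refl) (auto simp: pd_mult[OF mult.hyps(1)] algebra_simps)
  also have "\<dots> = x i *\<^sub>R F x + x i *\<^sub>R (real k *\<^sub>R F x)"
    using mult by (simp add: sum.distrib flip: scaleR_sum_right del: scaleR_scaleR)
  finally show ?case by (simp add: algebra_simps)
next
  case (add k F G)
  then show ?case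
    by (simp add: pd_add[OF add.hyps(1,2)] scaleR_add_right sum.distrib)
qed (simp_all add: pd_const)

lemma hom_poly_continuous:
  assumes "hom_poly m k F" "\<And>i. i \<le> m \<Longrightarrow> continuous_on U (\<lambda>y. X y i)"
  shows "continuous_on U (\<lambda>y. F (X y))"
  using assms by (induction rule: hom_poly.induct) (auto intro!: continuous_intros)

text \<open>  On a slice each coordinate with respect to \<open>v\<close> is a multiple of a single slice coordinate, and this case
  of linear substitution suffices.\<close>

lemma hom_poly_substitute:
  assumes "hom_poly n k F"
    and "\<And>i. i \<le> n \<Longrightarrow> \<exists>j\<le>m. \<exists>a. \<forall>x. X x i = a * x j"
  shows "hom_poly m k (\<lambda>x. F (X x))"
  using assms(1)
proof (induction rule: hom_poly.induct)
  case (mult k F i)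
  obtain j a where ja: "j \<le> m" "\<And>x. X x i = a * x j"
    using assms(2)[OF mult.hyps(2)] by blast
  have "hom_poly m (Suc k) (\<lambda>x. x j *\<^sub>R (a *\<^sub>R F (X x)))"
    by (intro hom_poly.mult hom_poly_linear[of _ _ _ "scaleR a"] mult ja linear_scaleR)
  then show ?case by (simp add: ja mult.commute)
qed (auto intro: hom_poly.intros)

section \<open>Multi-indices and coefficients\<close>

lemma finite_multi_indices_of_degree:
  assumes "finite I"
  shows "finite (multi_indices_of_degree I k)"
proof -
  have "multi_indices_of_degree I k \<subseteq> {f. \<forall>x. (x \<in> I \<longrightarrow> f x \<in> {..k}) \<and> (x \<notin> I \<longrightarrow> f x = 0)}"
    using assms by (auto simp: multi_indices_of_degree_def multi_indices_def intro: member_le_sum)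
  then show ?thesis
    by (rule finite_subset) (intro finite_set_of_finite_funs assms finite_atMost)
qed

lemma multi_indices_of_degree_0:
  "finite I \<Longrightarrow> multi_indices_of_degree I 0 = {\<lambda>_. 0}"
  by (auto simp: multi_indices_of_degree_def multi_indices_def fun_eq_iff)

lemma sum_increment:
  fixes \<kappa> :: "nat \<Rightarrow> nat"
  assumes "finite I" "i \<in> I"
  shows "sum (\<kappa>(i := Suc (\<kappa> i))) I = Suc (sum \<kappa> I)"
  using assms by (simp add: sum.remove[of I i])

lemma multi_indices_of_degree_Suc:
  assumes "finite I" "i \<in> I"
  shows "bij_betw (\<lambda>\<alpha>. \<alpha>(i := Suc (\<alpha> i))) (multi_indices_of_degree I k)
    {\<alpha> \<in> multi_indices_of_degree I (Suc k). \<alpha> i \<noteq> 0}"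
proof (rule bij_betwI[where g = "\<lambda>\<alpha>. \<alpha>(i := \<alpha> i - 1)"])
  show "(\<lambda>\<alpha>. \<alpha>(i := Suc (\<alpha> i))) \<in> multi_indices_of_degree I k \<rightarrow>
    {\<alpha> \<in> multi_indices_of_degree I (Suc k). \<alpha> i \<noteq> 0}"
    using assms sum_increment[OF assms]
    by (auto simp: multi_indices_of_degree_def multi_indices_def)
  show "(\<lambda>\<alpha>. \<alpha>(i := \<alpha> i - 1)) \<in> {\<alpha> \<in> multi_indices_of_degree I (Suc k). \<alpha> i \<noteq> 0} \<rightarrow>
    multi_indices_of_degree I k"
  proof safe
    fix \<alpha> assume *: "\<alpha> \<in> multi_indices_of_degree I (Suc k)" "0 < \<alpha> i"
    then show "\<alpha>(i := \<alpha> i - 1) \<in> multi_indices_of_degree I k"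
      using sum_increment[OF assms, of "\<alpha>(i := \<alpha> i - 1)"]
      by (auto simp: multi_indices_of_degree_def multi_indices_def)
  qed
qed auto

text \<open>  Multiplication by \<open>x i\<close> shifts the coefficients along \<open>\<alpha> \<mapsto> \<alpha> + \<epsilon> i\<close>, whose image consists of the
  multi-indices with a nonzero entry at \<open>i\<close>.\<close>

lemma hom_poly_coefficients:
  "hom_poly m k F \<Longrightarrow> \<exists>c. \<forall>x. F x =
     (\<Sum>\<alpha>\<in>multi_indices_of_degree {0..m} k. (\<Prod>i=0..m. x i ^ \<alpha> i) *\<^sub>R c \<alpha>)"
proof (induction rule: hom_poly.induct)
  case (const c)
  show ?case by (intro exI[of _ "\<lambda>_. c"]) (simp add: multi_indices_of_degree_0)
next
  case (zero k)
  show ?case by (intro exI[of _ "\<lambda>_. 0"]) simp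
next
  case (add k F G)
  then obtain c d where
    "\<And>x. F x = (\<Sum>\<alpha>\<in>multi_indices_of_degree {0..m} k. (\<Prod>i=0..m. x i ^ \<alpha> i) *\<^sub>R c \<alpha>)"
    "\<And>x. G x = (\<Sum>\<alpha>\<in>multi_indices_of_degree {0..m} k. (\<Prod>i=0..m. x i ^ \<alpha> i) *\<^sub>R d \<alpha>)"
    by blast
  then show ?case
    by (intro exI[of _ "\<lambda>\<alpha>. c \<alpha> + d \<alpha>"]) (simp add: scaleR_add_right sum.distrib)
next
  case (mult k F i)
  then obtain c where c:
    "\<And>x. F x = (\<Sum>\<alpha>\<in>multi_indices_of_degree {0..m} k. (\<Prod>i=0..m. x i ^ \<alpha> i) *\<^sub>R c \<alpha>)"
    by blast
  have i: "i \<in> {0..m}" using mult by simp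
  have "x i *\<^sub>R F x = (\<Sum>\<alpha>\<in>multi_indices_of_degree {0..m} (Suc k).
      (\<Prod>i=0..m. x i ^ \<alpha> i) *\<^sub>R (if \<alpha> i = 0 then 0 else c (\<alpha>(i := \<alpha> i - 1))))" (is "_ = sum ?g _") for x
  proof -
    have "sum ?g (multi_indices_of_degree {0..m} (Suc k)) =
       sum ?g {\<alpha> \<in> multi_indices_of_degree {0..m} (Suc k). \<alpha> i \<noteq> 0}"
      by (intro sum.mono_neutral_right finite_multi_indices_of_degree) auto
    also have "\<dots> = (\<Sum>\<alpha>\<in>multi_indices_of_degree {0..m} k. ?g (\<alpha>(i := Suc (\<alpha> i))))"
      by (rule sum.reindex_bij_betw[OF multi_indices_of_degree_Suc[OF _ i], symmetric]) simp
    also have "\<dots> = (\<Sum>\<alpha>\<in>multi_indices_of_degree {0..m} k. x i *\<^sub>R (\<Prod>i=0..m. x i ^ \<alpha> i) *\<^sub>R c \<alpha>)"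
      by (intro sum.cong refl) (use i in \<open>simp add: prod.remove[of "{0..m}" i]\<close>)
    finally show ?thesis by (simp add: c scaleR_sum_right)
  qed
  then show ?case by (intro exI[of _ "\<lambda>\<alpha>. if \<alpha> i = 0 then 0 else c (\<alpha>(i := \<alpha> i - 1))"]) blast
qed

lemma hom_poly_power:
  assumes "hom_poly m k F" "i \<le> m"
  shows "hom_poly m (j + k) (\<lambda>x. x i ^ j *\<^sub>R F x)"
proof (induction j)
  case (Suc j)
  then show ?case using hom_poly.mult[OF Suc assms(2)] by simp
qed (use assms in simp)

lemma hom_poly_monomial:
  assumes "finite I" "I \<subseteq> {0..m}"
  shows "hom_poly m (sum \<alpha> I) (\<lambda>x. (\<Prod>i\<in>I. x i ^ \<alpha> i) *\<^sub>R c)"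
  using assms
proof (induction I)
  case empty
  then show ?case by (simp add: hom_poly.const)
next
  case (insert i I)
  then show ?case
    using hom_poly_power[of m "sum \<alpha> I" "\<lambda>x. (\<Prod>i\<in>I. x i ^ \<alpha> i) *\<^sub>R c" i "\<alpha> i"] by simp
qed

lemma hom_poly_of_coefficients:
  "hom_poly m k (\<lambda>x. \<Sum>\<alpha>\<in>multi_indices_of_degree {0..m} k. (\<Prod>i=0..m. x i ^ \<alpha> i) *\<^sub>R c \<alpha>)"
proof (rule hom_poly_sum)
  fix \<alpha> assume "\<alpha> \<in> multi_indices_of_degree {0..m} k"
  then show "hom_poly m k (\<lambda>x. (\<Prod>i=0..m. x i ^ \<alpha> i) *\<^sub>R c \<alpha>)"
    using hom_poly_monomial[of "{0..m}" m \<alpha> "c \<alpha>"] by (auto simp: multi_indices_of_degree_def)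
qed

text \<open>Index ranges are written \<open>{1..m}\<close> throughout and are kept in this form.\<close>

declare One_nat_def [simp del]

section \<open>Uniqueness of the Cauchy-Kovalevskaya extension\<close>

definition monogenic ::
    "(nat \<Rightarrow> 'a::{real_algebra_1, euclidean_space}) \<Rightarrow> nat \<Rightarrow> ((nat \<Rightarrow> real) \<Rightarrow> 'a) \<Rightarrow> bool" where
  "monogenic w m F \<longleftrightarrow> (\<forall>x. (\<Sum>s=0..m. w s * pd s F x) = 0)"

lemma bounded_linear_mult_const:
  fixes c :: "'a::{real_algebra_1, euclidean_space}"
  shows "bounded_linear (\<lambda>x. x * c)" "bounded_linear (\<lambda>x. c * x)"
  unfolding linear_conv_bounded_linear[symmetric] by (auto intro!: linearI simp: algebra_simps)

lemmas linear_mult_const = bounded_linear_mult_const[THEN bounded_linear.linear]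

text \<open>  The operator has constant coefficients and therefore commutes with \<open>\<partial>u\<close>.\<close>

lemma monogenic_pd:
  assumes "hom_poly m k F" "monogenic w m F"
  shows "monogenic w m (pd u F)"
proof -
  have "(\<Sum>s=0..m. w s * pd s (pd u F) x) = pd u (\<lambda>x. \<Sum>s=0..m. w s * pd s F x) x" for x
  proof -
    have "pd u (\<lambda>x. \<Sum>s=0..m. w s * pd s F x) = (\<lambda>x. \<Sum>s=0..m. pd u (\<lambda>x. w s * pd s F x) x)"
      by (rule pd_sum, rule hom_poly_linear[OF hom_poly_pd[OF assms(1)] linear_mult_const(2)])
    then show ?thesis
      by (simp add: pd_linear[OF hom_poly_pd[OF assms(1)] bounded_linear_mult_const(2)]
          pd_commute[OF assms(1), of _ u])
  qed
  then show ?thesis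
    using assms(2) by (simp add: monogenic_def pd_const)
qed

lemma pd_eq_0_on_hyperplane:
  assumes "\<And>x. x j = 0 \<Longrightarrow> F x = 0" "s \<noteq> j" "x j = 0"
  shows "pd s F x = 0"
proof -
  have "(\<lambda>r. F (x(s := x s + r))) = (\<lambda>r. 0)"
    using assms by auto
  then show ?thesis by (simp add: pd_def)
qed

text \<open>  Induction on the degree. The tangential derivatives are again monogenic and vanish on the hyperplane, so
  they are zero; the equation then leaves \<open>w j * \<partial>j F = 0\<close>, and \<open>w j\<close> is invertible. Since all partial
  derivatives are zero, Euler's identity gives \<open>F = 0\<close>.\<close>

lemma monogenic_eq_0_if_0_on_hyperplane:
  assumes "hom_poly m k F" "monogenic w m F" "j \<le> m" "b * w j = 1"
    and "\<And>x. x j = 0 \<Longrightarrow> F x = 0"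
  shows "F x = 0"
  using assms(1,2,5)
proof (induction k arbitrary: F x)
  case 0
  from 0(1) obtain c where "F = (\<lambda>x. c)"
    using hom_poly_coefficients[OF 0(1)] by (auto simp: multi_indices_of_degree_0)
  with 0(3)[of "\<lambda>_. 0"] show ?case by simp
next
  case (Suc k)
  have tangential: "pd s F y = 0" if "s \<noteq> j" for s y
    using Suc.IH[OF _ monogenic_pd[OF Suc.prems(1,2)], of s] hom_poly_pd[OF Suc.prems(1), of s]
      pd_eq_0_on_hyperplane[OF Suc.prems(3) that] by simp
  have normal: "pd j F y = 0" for y
  proof -
    have "0 = (\<Sum>s=0..m. w s * pd s F y)" using Suc.prems(2) by (simp add: monogenic_def)
    also have "\<dots> = w j * pd j F y"
      using assms(3) by (subst sum.remove[of _ j]) (auto simp: tangential)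
    finally have "b * (w j * pd j F y) = 0" by simp
    then show ?thesis by (simp add: assms(4) flip: mult.assoc)
  qed
  have "pd s F x = 0" for s using tangential normal by (cases "s = j") auto
  then show ?case using hom_poly_euler[OF Suc.prems(1), of x] by (simp del: of_nat_Suc)
qed

section \<open>Fueter polynomials\<close>

definition decr :: "nat \<Rightarrow> (nat \<Rightarrow> int) \<Rightarrow> nat \<Rightarrow> int" where
  "decr s l = l(s := l s - 1)"

text \<open>  With formal real variables \<open>\<xi> s\<close>, the polynomial with index \<open>l\<close> is the coefficient of \<open>\<xi> ^ l\<close> in
  \<open>exp (\<Sum>s \<xi> s (x s - x 0 * w s))\<close>. Indices are integers: coefficients with a negative entry are zero, and
  then lowering an index needs no case distinction. The degree \<open>k\<close> is carried along as the argument of the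
  recursion and is meant to be the sum of the entries of \<open>l\<close>.\<close>

primrec fueter_deg ::
    "(nat \<Rightarrow> 'a::{real_algebra_1, euclidean_space}) \<Rightarrow> nat \<Rightarrow> nat \<Rightarrow> (nat \<Rightarrow> int) \<Rightarrow> (nat \<Rightarrow> real) \<Rightarrow> 'a"
  where
  "fueter_deg w m 0 l = (\<lambda>x. if \<forall>s\<in>{1..m}. l s = 0 then 1 else 0)"
| "fueter_deg w m (Suc k) l = (\<lambda>x. (1 / real (Suc k)) *\<^sub>R
     (\<Sum>s=1..m. fueter_deg w m k (decr s l) x * (of_real (x s) - x 0 *\<^sub>R w s)))"

definition fueter ::
    "(nat \<Rightarrow> 'a::{real_algebra_1, euclidean_space}) \<Rightarrow> nat \<Rightarrow> (nat \<Rightarrow> int) \<Rightarrow> (nat \<Rightarrow> real) \<Rightarrow> 'a" where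
  "fueter w m l = fueter_deg w m (nat (\<Sum>s=1..m. l s)) l"

lemma decr_commute: "decr s (decr u l) = decr u (decr s l)"
  by (auto simp: decr_def fun_eq_iff)

lemma sum_decr: 
  assumes "s \<in> {1..m}"
  shows "(\<Sum>u=1..m. decr s l u) = (\<Sum>u=1..m. l u) - 1"
proof -
  have "finite I \<Longrightarrow> s \<in> I \<Longrightarrow> sum (decr s l) I = sum l I - 1" for I
    by (simp add: decr_def sum.remove[of I s])
  then show ?thesis using assms by blast
qed

lemma fueter_deg_negative_index:
  "s \<in> {1..m} \<Longrightarrow> l s < 0 \<Longrightarrow> fueter_deg w m k l x = 0"
proof (induction k arbitrary: l)
  case (Suc k)
  then have "fueter_deg w m k (decr u l) x = 0" for u by (intro Suc.IH) (auto simp: decr_def)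
  then show ?case by simp
qed force

lemma fueter_negative_index:
  "s \<in> {1..m} \<Longrightarrow> l s < 0 \<Longrightarrow> fueter w m l x = 0"
  by (simp add: fueter_def fueter_deg_negative_index)

lemma fueter_negative_degree:
  assumes "(\<Sum>s=1..m. l s) < 0"
  shows "fueter w m l x = 0"
proof -
  obtain s where "s \<in> {1..m}" "l s < 0"
    using assms by (meson not_less sum_nonneg)
  then show ?thesis by (rule fueter_negative_index)
qed

lemma fueter_degree_0:
  assumes "(\<Sum>s=1..m. l s) = 0"
  shows "fueter w m l = (\<lambda>x. if \<forall>s\<in>{1..m}. l s = 0 then 1 else 0)"
  using assms by (simp add: fueter_def)

text \<open>  In terms of the exponential, this is the Euler operator in the variables \<open>\<xi>\<close> applied to it. The identity
  holds for all integer indices, both sides being zero when the degree is not positive.\<close>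

lemma fueter_rec:
  "of_int (\<Sum>s=1..m. l s) *\<^sub>R fueter w m l x =
     (\<Sum>s=1..m. fueter w m (decr s l) x * (of_real (x s) - x 0 *\<^sub>R w s))"
proof (cases "(\<Sum>s=1..m. l s) \<le> 0")
  case True
  have "fueter w m (decr s l) x = 0" if "s \<in> {1..m}" for s
    using True sum_decr[OF that, of l] by (intro fueter_negative_degree) simp
  then have "(\<Sum>s=1..m. fueter w m (decr s l) x * (of_real (x s) - x 0 *\<^sub>R w s)) = 0"
    by simp
  moreover have "of_int (\<Sum>s=1..m. l s) *\<^sub>R fueter w m l x = 0"
    using True fueter_negative_degree[of l m w x] by (cases "(\<Sum>s=1..m. l s) = 0") auto
  ultimately show ?thesis by simp
next
  case False
  then obtain k where k: "(\<Sum>s=1..m. l s) = int (Suc k)"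
    by (metis not_less_eq_eq zero_less_imp_eq_int not_le gr0_conv_Suc)
  have "fueter w m (decr s l) = fueter_deg w m k (decr s l)" if "s \<in> {1..m}" for s
    unfolding fueter_def sum_decr[OF that] k by simp
  moreover have "fueter w m l = fueter_deg w m (Suc k) l"
    unfolding fueter_def k nat_int by (rule refl)
  ultimately show ?thesis by (simp add: k)
qed

lemma mult_fueter_variable:
  fixes G :: "(nat \<Rightarrow> real) \<Rightarrow> 'a::{real_algebra_1, euclidean_space}"
  shows "G x * (of_real (x s) - x 0 *\<^sub>R c) = x s *\<^sub>R G x + x 0 *\<^sub>R (G x * (- c))"
  by (simp add: of_real_def algebra_simps)

lemma hom_poly_fueter_deg: "hom_poly m k (fueter_deg w m k l)"
proof (induction k arbitrary: l)
  case 0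
  show ?case by (auto intro: hom_poly.intros)
next
  case (Suc k)
  show ?case
    unfolding fueter_deg.simps mult_fueter_variable
    by (intro hom_poly_linear[OF _ linear_scaleR] hom_poly_sum hom_poly.add hom_poly.mult
          hom_poly_linear[OF _ linear_mult_const(1)] Suc) auto
qed

lemma hom_poly_fueter:
  "(\<Sum>s=1..m. l s) = int k \<Longrightarrow> hom_poly m k (fueter w m l)"
  by (simp add: fueter_def hom_poly_fueter_deg)

lemma hom_poly_fueter_nat: "hom_poly m (nat (\<Sum>s=1..m. l s)) (fueter w m l)"
  by (simp add: fueter_def hom_poly_fueter_deg)

text \<open>  The coefficients of the product of the exponential with \<open>\<Sum>s \<xi> s w s\<close>, on the right and on the left. They
  agree because, up to real terms and the real factor \<open>- x 0\<close>, this sum is the exponent itself. The proof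
  shows that both families satisfy the recursion of the exponential, with the degree lowered by one.\<close>

definition fueter_right ::
    "(nat \<Rightarrow> 'a::{real_algebra_1, euclidean_space}) \<Rightarrow> nat \<Rightarrow> (nat \<Rightarrow> int) \<Rightarrow> (nat \<Rightarrow> real) \<Rightarrow> 'a" where
  "fueter_right w m l x = (\<Sum>s=1..m. fueter w m (decr s l) x * w s)"

definition fueter_left ::
    "(nat \<Rightarrow> 'a::{real_algebra_1, euclidean_space}) \<Rightarrow> nat \<Rightarrow> (nat \<Rightarrow> int) \<Rightarrow> (nat \<Rightarrow> real) \<Rightarrow> 'a" where
  "fueter_left w m l x = (\<Sum>s=1..m. w s * fueter w m (decr s l) x)"

lemma fueter_rec_decr:
  assumes "s \<in> {1..m}"
  shows "of_int ((\<Sum>s=1..m. l s) - 1) *\<^sub>R fueter w m (decr s l) x =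
     (\<Sum>u=1..m. fueter w m (decr u (decr s l)) x * (of_real (x u) - x 0 *\<^sub>R w u))"
  using fueter_rec[of "decr s l" m w x] unfolding sum_decr[OF assms] .

lemma fueter_left_rec:
  "of_int ((\<Sum>s=1..m. l s) - 1) *\<^sub>R fueter_left w m l x =
     (\<Sum>u=1..m. fueter_left w m (decr u l) x * (of_real (x u) - x 0 *\<^sub>R w u))"
proof -
  have "of_int ((\<Sum>s=1..m. l s) - 1) *\<^sub>R fueter_left w m l x =
    (\<Sum>s=1..m. w s * (of_int ((\<Sum>s=1..m. l s) - 1) *\<^sub>R fueter w m (decr s l) x))"
    by (simp add: fueter_left_def scaleR_sum_right)
  also have "\<dots> = (\<Sum>s=1..m. w s * (\<Sum>u=1..m. fueter w m (decr u (decr s l)) x * (of_real (x u) - x 0 *\<^sub>R w u)))"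
    by (intro sum.cong refl) (simp only: fueter_rec_decr)
  also have "\<dots> = (\<Sum>u=1..m. \<Sum>s=1..m. w s * fueter w m (decr u (decr s l)) x * (of_real (x u) - x 0 *\<^sub>R w u))"
    by (subst sum.swap) (simp add: sum_distrib_left mult.assoc)
  also have "\<dots> = (\<Sum>u=1..m. fueter_left w m (decr u l) x * (of_real (x u) - x 0 *\<^sub>R w u))"
    by (simp only: fueter_left_def sum_distrib_right decr_commute)
  finally show ?thesis .
qed

lemma fueter_right_rec:
  "of_int ((\<Sum>s=1..m. l s) - 1) *\<^sub>R fueter_right w m l x =
     (\<Sum>u=1..m. fueter_right w m (decr u l) x * (of_real (x u) - x 0 *\<^sub>R w u))"
proof -
  \<comment> \<open>Because \<open>G\<close> is symmetric, the double sums over \<open>G s u * w u * w s\<close> and \<open>G s u * w s * w u\<close> agree although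
    the units do not commute.\<close>
  define G where "G s u = fueter w m (decr u (decr s l)) x" for s u
  have G: "G s u = G u s" for s u
    unfolding G_def by (simp only: decr_commute)
  have "of_int ((\<Sum>s=1..m. l s) - 1) *\<^sub>R fueter_right w m l x =
    (\<Sum>s=1..m. (of_int ((\<Sum>s=1..m. l s) - 1) *\<^sub>R fueter w m (decr s l) x) * w s)"
    by (simp add: fueter_right_def scaleR_sum_right)
  also have "\<dots> = (\<Sum>s=1..m. (\<Sum>u=1..m. G s u * (of_real (x u) - x 0 *\<^sub>R w u)) * w s)"
    by (intro sum.cong refl) (simp only: fueter_rec_decr G_def)
  also have "\<dots> = (\<Sum>s=1..m. \<Sum>u=1..m. x u *\<^sub>R (G s u * w s)) - x 0 *\<^sub>R (\<Sum>s=1..m. \<Sum>u=1..m. G s u * w u * w s)"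
    by (simp add: of_real_def algebra_simps sum_distrib_right sum_subtractf scaleR_sum_right)
  also have "(\<Sum>s=1..m. \<Sum>u=1..m. x u *\<^sub>R (G s u * w s)) = (\<Sum>u=1..m. \<Sum>s=1..m. x u *\<^sub>R (G u s * w s))"
    by (subst sum.swap) (simp only: G)
  also have "(\<Sum>u=1..m. \<Sum>s=1..m. x u *\<^sub>R (G u s * w s)) - x 0 *\<^sub>R (\<Sum>s=1..m. \<Sum>u=1..m. G s u * w u * w s)
     = (\<Sum>u=1..m. (\<Sum>s=1..m. G u s * w s) * (of_real (x u) - x 0 *\<^sub>R w u))"
    by (simp add: of_real_def algebra_simps sum_distrib_right sum_subtractf scaleR_sum_right)
  finally show ?thesis by (simp only: fueter_right_def G_def)
qed

lemma fueter_left_eq_right: "fueter_left w m l x = fueter_right w m l x"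
proof (induction "nat (\<Sum>s=1..m. l s)" arbitrary: l rule: less_induct)
  case less
  consider "(\<Sum>s=1..m. l s) \<le> 0" | "(\<Sum>s=1..m. l s) = 1" | "(\<Sum>s=1..m. l s) > 1" by linarith
  then show ?case
  proof cases
    case 1
    have "fueter w m (decr s l) x = 0" if "s \<in> {1..m}" for s
      using 1 sum_decr[OF that, of l] by (intro fueter_negative_degree) simp
    then show ?thesis by (simp add: fueter_left_def fueter_right_def)
  next
    case 2
    \<comment> \<open>The recursion multiplies by the degree minus one and gives nothing here, but polynomials of degree
      \<open>0\<close> are \<open>0\<close> or \<open>1\<close> and commute with everything.\<close>
    have "w s * fueter w m (decr s l) x = fueter w m (decr s l) x * w s" if "s \<in> {1..m}" for s
    proof -
      have "(\<Sum>u=1..m. decr s l u) = 0" using 2 sum_decr[OF that, of l] by simp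
      from fueter_degree_0[OF this, of w] show ?thesis by simp
    qed
    then show ?thesis by (simp add: fueter_left_def fueter_right_def)
  next
    case 3
    have "fueter_left w m (decr u l) x = fueter_right w m (decr u l) x" if "u \<in> {1..m}" for u
      by (rule less) (use 3 sum_decr[OF that, of l] in simp)
    then have "of_int ((\<Sum>s=1..m. l s) - 1) *\<^sub>R fueter_left w m l x =
      of_int ((\<Sum>s=1..m. l s) - 1) *\<^sub>R fueter_right w m l x"
      by (simp only: fueter_left_rec fueter_right_rec cong: sum.cong)
    moreover have "of_int ((\<Sum>s=1..m. l s) - 1) \<noteq> (0::real)" using 3 by linarith
    ultimately show ?thesis by (rule scaleR_left_imp_eq[rotated])
  qed
qed

lemma pd_mult_fueter_variable:
  fixes G :: "(nat \<Rightarrow> real) \<Rightarrow> 'a::{real_algebra_1, euclidean_space}"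
  assumes "hom_poly m k G" "u \<le> m"
  shows "pd s (\<lambda>x. G x * (of_real (x u) - x 0 *\<^sub>R c)) =
    (\<lambda>x. pd s G x * (of_real (x u) - x 0 *\<^sub>R c) +
       ((if u = s then G x else 0) - (if s = 0 then G x * c else 0)))"
proof -
  have 0: "hom_poly m k (\<lambda>x. G x * - c)"
    by (rule hom_poly_linear[OF assms(1) linear_mult_const(1)])
  have 1: "hom_poly m (Suc k) (\<lambda>x. x u *\<^sub>R G x)" using assms by (rule hom_poly.mult)
  have 2: "hom_poly m (Suc k) (\<lambda>x. x 0 *\<^sub>R (G x * - c))" using 0 by (rule hom_poly.mult) simp
  show ?thesis
    unfolding mult_fueter_variable pd_add[OF 1 2] pd_mult[OF assms(1)] pd_mult[OF 0]
      pd_linear[OF assms(1) bounded_linear_mult_const(1)]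
    by (auto simp: fun_eq_iff)
qed

lemma pd_fueter_rec:
  "of_int (\<Sum>s=1..m. l s) *\<^sub>R pd s (fueter w m l) x =
     (\<Sum>u=1..m. pd s (fueter w m (decr u l)) x * (of_real (x u) - x 0 *\<^sub>R w u) +
       ((if u = s then fueter w m (decr u l) x else 0) -
        (if s = 0 then fueter w m (decr u l) x * w u else 0)))"
proof -
  have "of_int (\<Sum>s=1..m. l s) *\<^sub>R pd s (fueter w m l) x
     = pd s (\<lambda>x. of_int (\<Sum>s=1..m. l s) *\<^sub>R fueter w m l x) x"
    by (subst pd_linear[OF hom_poly_fueter_nat bounded_linear_scaleR_right]) simp
  also have "(\<lambda>x. of_int (\<Sum>s=1..m. l s) *\<^sub>R fueter w m l x) =
     (\<lambda>x. \<Sum>u=1..m. fueter w m (decr u l) x * (of_real (x u) - x 0 *\<^sub>R w u))"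
    by (rule ext) (rule fueter_rec)
  also have "pd s \<dots> = (\<lambda>x. \<Sum>u=1..m. pd s (\<lambda>x. fueter w m (decr u l) x * (of_real (x u) - x 0 *\<^sub>R w u)) x)"
  proof (rule pd_sum)
    fix u assume u: "u \<in> {1..m}"
    show "hom_poly m (Suc (nat (\<Sum>s=1..m. decr u l s)))
      (\<lambda>x. fueter w m (decr u l) x * (of_real (x u) - x 0 *\<^sub>R w u))"
      unfolding mult_fueter_variable using u
      by (intro hom_poly.add hom_poly.mult hom_poly_linear[OF _ linear_mult_const(1)] hom_poly_fueter_nat) auto
  qed
  finally show ?thesis
    by (simp add: pd_mult_fueter_variable[OF hom_poly_fueter_nat])
qed

lemma pd_fueter_degree_le_0:
  assumes "(\<Sum>s=1..m. l s) \<le> 0"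
  shows "pd s (fueter w m l) x = 0"
  using hom_poly_fueter_nat[of m l w] assms by (simp add: pd_hom_poly_0)

text \<open>  Differentiating the exponential with respect to \<open>x s\<close> multiplies it by the real variable \<open>\<xi> s\<close>.\<close>

lemma pd_fueter:
  assumes "s \<in> {1..m}"
  shows "pd s (fueter w m l) = fueter w m (decr s l)"
proof
  fix x show "pd s (fueter w m l) x = fueter w m (decr s l) x"
  proof (induction "nat (\<Sum>s=1..m. l s)" arbitrary: l rule: less_induct)
    case less
    let ?d = "\<Sum>s=1..m. l s"
    show ?case
    proof (cases "?d \<le> 0")
      case True
      then show ?thesis
        using sum_decr[OF assms, of l] by (simp add: pd_fueter_degree_le_0 fueter_negative_degree)
    next
      case False
      have IH: "pd s (fueter w m (decr u l)) x = fueter w m (decr s (decr u l)) x" if "u \<in> {1..m}" for u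
        by (rule less) (use False sum_decr[OF that, of l] in simp)
      have s0: "s \<noteq> 0" using assms by simp
      have "of_int ?d *\<^sub>R pd s (fueter w m l) x =
        (\<Sum>u=1..m. fueter w m (decr u (decr s l)) x * (of_real (x u) - x 0 *\<^sub>R w u) +
           (if u = s then fueter w m (decr u l) x else 0))"
        unfolding pd_fueter_rec
      proof (rule sum.cong[OF refl])
        fix u assume u: "u \<in> {1..m}"
        show "pd s (fueter w m (decr u l)) x * (of_real (x u) - x 0 *\<^sub>R w u) +
            ((if u = s then fueter w m (decr u l) x else 0) - (if s = 0 then fueter w m (decr u l) x * w u else 0)) =
          fueter w m (decr u (decr s l)) x * (of_real (x u) - x 0 *\<^sub>R w u) +
            (if u = s then fueter w m (decr u l) x else 0)"
          unfolding IH[OF u] decr_commute[of s u] using s0 by simp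
      qed
      also have "\<dots> = of_int (?d - 1) *\<^sub>R fueter w m (decr s l) x + fueter w m (decr s l) x"
        using assms unfolding sum.distrib fueter_rec_decr[OF assms] by simp
      also have "\<dots> = of_int ?d *\<^sub>R fueter w m (decr s l) x" by (simp add: algebra_simps)
      finally have "of_int ?d *\<^sub>R pd s (fueter w m l) x = of_int ?d *\<^sub>R fueter w m (decr s l) x" .
      moreover have "real_of_int ?d \<noteq> 0" using False by (subst of_int_eq_0_iff) simp
      ultimately show ?thesis by (rule scaleR_left_imp_eq[rotated])
    qed
  qed
qed

text \<open>  Differentiating the exponential with respect to \<open>x 0\<close> multiplies it by \<open>- (\<Sum>s \<xi> s w s)\<close>. The recursion
  produces this factor on the right, whereas being monogenic requires it on the left.\<close>

lemma pd_0_fueter: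
  "pd 0 (fueter w m l) x = - fueter_right w m l x"
proof (induction "nat (\<Sum>s=1..m. l s)" arbitrary: l rule: less_induct)
  case less
  let ?d = "\<Sum>s=1..m. l s"
  show ?case
  proof (cases "?d \<le> 0")
    case True
    have "fueter w m (decr s l) x = 0" if "s \<in> {1..m}" for s
      using True sum_decr[OF that, of l] by (intro fueter_negative_degree) simp
    then show ?thesis
      using True by (simp add: pd_fueter_degree_le_0 fueter_right_def)
  next
    case False
    have IH: "pd 0 (fueter w m (decr u l)) x = - fueter_right w m (decr u l) x" if "u \<in> {1..m}" for u
      by (rule less) (use False sum_decr[OF that, of l] in simp)
    have "of_int ?d *\<^sub>R pd 0 (fueter w m l) x =
      (\<Sum>u=1..m. - (fueter_right w m (decr u l) x * (of_real (x u) - x 0 *\<^sub>R w u)) -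
         fueter w m (decr u l) x * w u)"
      unfolding pd_fueter_rec
    proof (rule sum.cong[OF refl])
      fix u assume u: "u \<in> {1..m}"
      show "pd 0 (fueter w m (decr u l)) x * (of_real (x u) - x 0 *\<^sub>R w u) +
          ((if u = 0 then fueter w m (decr u l) x else 0) - (if 0 = (0::nat) then fueter w m (decr u l) x * w u else 0)) =
        - (fueter_right w m (decr u l) x * (of_real (x u) - x 0 *\<^sub>R w u)) - fueter w m (decr u l) x * w u"
        unfolding IH[OF u] using u by simp
    qed
    also have "\<dots> = - (of_int (?d - 1) *\<^sub>R fueter_right w m l x) - fueter_right w m l x"
      unfolding sum_subtractf sum_negf fueter_right_rec by (simp add: fueter_right_def)
    also have "\<dots> = of_int ?d *\<^sub>R (- fueter_right w m l x)" by (simp add: algebra_simps)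
    finally have "of_int ?d *\<^sub>R pd 0 (fueter w m l) x = of_int ?d *\<^sub>R (- fueter_right w m l x)" .
    moreover have "real_of_int ?d \<noteq> 0" using False by (subst of_int_eq_0_iff) simp
    ultimately show ?thesis by (rule scaleR_left_imp_eq[rotated])
  qed
qed

lemma monogenic_fueter:
  assumes "w 0 = 1"
  shows "monogenic w m (fueter w m l)"
  unfolding monogenic_def
proof
  fix x
  have "(\<Sum>s=0..m. w s * pd s (fueter w m l) x)
     = w 0 * pd 0 (fueter w m l) x + (\<Sum>s=1..m. w s * pd s (fueter w m l) x)"
    by (simp add: sum.atLeast_Suc_atMost One_nat_def)
  also have "(\<Sum>s=1..m. w s * pd s (fueter w m l) x) = fueter_left w m l x"
    unfolding fueter_left_def by (intro sum.cong refl) (simp add: pd_fueter)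
  finally show "(\<Sum>s=0..m. w s * pd s (fueter w m l) x) = 0"
    by (simp add: assms pd_0_fueter fueter_left_eq_right)
qed

lemma fueter_at_0:
  "fueter w m l (\<lambda>_. 0) = (if \<forall>s\<in>{1..m}. l s = 0 then 1 else 0)"
proof (cases "(\<Sum>s=1..m. l s) = 0")
  case False
  then have "fueter w m l (\<lambda>_. 0) = 0"
    using fueter_rec[of l m w "\<lambda>_. 0"] by (simp del: of_int_sum)
  moreover have "\<not> (\<forall>s\<in>{1..m}. l s = 0)" using False sum.neutral by blast
  ultimately show ?thesis by simp
qed (simp add: fueter_degree_0)

lemma decr_of_nat:
  "\<kappa> s \<noteq> 0 \<Longrightarrow> decr s (\<lambda>i. int (\<kappa> i)) = (\<lambda>i. int ((\<kappa>(s := \<kappa> s - 1)) i))"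
  by (auto simp: decr_def fun_eq_iff)

lemma multi_fact_decrement:
  assumes "finite I" "s \<in> I" "\<kappa> s \<noteq> 0"
  shows "multi_fact I \<kappa> = \<kappa> s * multi_fact I (\<kappa>(s := \<kappa> s - 1))"
  using assms by (simp add: multi_fact_def prod.remove[of I s] fact_reduce[of "\<kappa> s"])

lemma multi_fact_pos: "multi_fact I \<kappa> > 0"
  by (simp add: multi_fact_def prod_pos)

text \<open>  For \<open>x 0 = 0\<close> the variables are real, and the exponential is the usual one.\<close>

lemma fueter_on_hyperplane_0:
  assumes "x 0 = 0"
  shows "real (multi_fact {1..m} \<kappa>) *\<^sub>R fueter w m (\<lambda>s. int (\<kappa> s)) x =
    of_real (\<Prod>s=1..m. x s ^ \<kappa> s)"
proof (induction "\<Sum>s=1..m. \<kappa> s" arbitrary: \<kappa> rule: less_induct)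
  case less
  let ?l = "\<lambda>s. int (\<kappa> s)"
  show ?case
  proof (cases "(\<Sum>s=1..m. \<kappa> s) = 0")
    case True
    then show ?thesis
      by (simp add: fueter_degree_0 multi_fact_def)
  next
    case False
    have "real (\<Sum>s=1..m. \<kappa> s) *\<^sub>R fueter w m ?l x = (\<Sum>s=1..m. fueter w m (decr s ?l) x * of_real (x s))"
      using fueter_rec[of ?l m w x] assms by simp
    then have rec: "real (multi_fact {1..m} \<kappa>) *\<^sub>R (real (\<Sum>s=1..m. \<kappa> s) *\<^sub>R fueter w m ?l x) =
        real (multi_fact {1..m} \<kappa>) *\<^sub>R (\<Sum>s=1..m. fueter w m (decr s ?l) x * of_real (x s))"
      by (rule arg_cong)
    have "real (\<Sum>s=1..m. \<kappa> s) *\<^sub>R (real (multi_fact {1..m} \<kappa>) *\<^sub>R fueter w m ?l x) =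
      real (multi_fact {1..m} \<kappa>) *\<^sub>R (\<Sum>s=1..m. fueter w m (decr s ?l) x * of_real (x s))"
      by (rule trans[OF scaleR_left_commute rec])
    also have "\<dots> = (\<Sum>s=1..m. real (\<kappa> s) *\<^sub>R of_real (\<Prod>s=1..m. x s ^ \<kappa> s))"
      unfolding scaleR_sum_right
    proof (rule sum.cong[OF refl])
      fix s assume s: "s \<in> {1..m}"
      show "real (multi_fact {1..m} \<kappa>) *\<^sub>R (fueter w m (decr s ?l) x * of_real (x s)) =
        real (\<kappa> s) *\<^sub>R of_real (\<Prod>s=1..m. x s ^ \<kappa> s)"
      proof (cases "\<kappa> s = 0")
        case True
        then show ?thesis using fueter_negative_index[OF s, of "decr s ?l" w x] by (simp add: decr_def)
      next
        case nz: False
        let ?\<kappa>' = "\<kappa>(s := \<kappa> s - 1)"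
        have IH: "real (multi_fact {1..m} ?\<kappa>') *\<^sub>R fueter w m (decr s ?l) x =
            of_real (\<Prod>s=1..m. x s ^ ?\<kappa>' s)"
          unfolding decr_of_nat[of \<kappa> s, OF nz]
          by (rule less) (rule sum_decrement_less[where I = "{1..m}" and \<kappa> = \<kappa>, OF finite_atLeastAtMost s nz])
        have "(\<Prod>s=1..m. x s ^ \<kappa> s) = (\<Prod>s=1..m. x s ^ ?\<kappa>' s) * x s"
          using s nz by (simp add: prod.remove[of "{1..m}" s] power_eq_if[of "x s" "\<kappa> s"])
        moreover have "real (multi_fact {1..m} \<kappa>) = real (\<kappa> s) * real (multi_fact {1..m} ?\<kappa>')"
          using multi_fact_decrement[of "{1..m}" s \<kappa>] s nz by simp
        ultimately show ?thesis
          using IH by (simp flip: scaleR_scaleR mult_scaleR_left del: fun_upd_apply)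
      qed
    qed
    also have "\<dots> = real (\<Sum>s=1..m. \<kappa> s) *\<^sub>R of_real (\<Prod>s=1..m. x s ^ \<kappa> s)"
      by (simp add: scaleR_sum_left)
    finally have "real (\<Sum>s=1..m. \<kappa> s) *\<^sub>R (real (multi_fact {1..m} \<kappa>) *\<^sub>R fueter w m ?l x) =
      real (\<Sum>s=1..m. \<kappa> s) *\<^sub>R of_real (\<Prod>s=1..m. x s ^ \<kappa> s)" .
    moreover have "real (\<Sum>s=1..m. \<kappa> s) \<noteq> 0" using False by (simp del: of_nat_sum)
    ultimately show ?thesis by (rule scaleR_left_imp_eq[rotated])
  qed
qed

lemma monogenic_combination:
  assumes "\<And>i. i \<in> I \<Longrightarrow> hom_poly m k (F i)" "\<And>i. i \<in> I \<Longrightarrow> monogenic w m (F i)"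
  shows "monogenic w m (\<lambda>x. \<Sum>i\<in>I. F i x * c i)"
  unfolding monogenic_def
proof
  fix x
  have "pd s (\<lambda>x. \<Sum>i\<in>I. F i x * c i) = (\<lambda>x. \<Sum>i\<in>I. pd s (F i) x * c i)" for s
    using assms(1)
    by (subst pd_sum[where m = m and k = "\<lambda>_. k"])
       (auto intro!: hom_poly_linear[OF _ linear_mult_const(1)] ext sum.cong
          simp: pd_linear[OF assms(1) bounded_linear_mult_const(1)])
  then have "(\<Sum>s=0..m. w s * pd s (\<lambda>x. \<Sum>i\<in>I. F i x * c i) x) =
     (\<Sum>s=0..m. \<Sum>i\<in>I. w s * pd s (F i) x * c i)"
    by (simp add: sum_distrib_left mult.assoc)
  also have "\<dots> = (\<Sum>i\<in>I. (\<Sum>s=0..m. w s * pd s (F i) x) * c i)"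
    by (subst sum.swap) (simp add: sum_distrib_right)
  also have "\<dots> = 0"
    using assms(2) by (simp add: monogenic_def)
  finally show "(\<Sum>s=0..m. w s * pd s (\<lambda>x. \<Sum>i\<in>I. F i x * c i) x) = 0" .
qed

lemma monogenic_diff:
  assumes "hom_poly m k F" "hom_poly m k G" "monogenic w m F" "monogenic w m G"
  shows "monogenic w m (\<lambda>x. F x - G x)"
proof -
  have "monogenic w m (\<lambda>x. \<Sum>i\<in>(UNIV::bool set). (if i then F else G) x * (if i then 1 else -1))"
    by (rule monogenic_combination[where k = k]) (use assms in auto)
  then show ?thesis by (simp add: UNIV_bool)
qed

lemma hom_poly_combination:
  fixes F :: "'i \<Rightarrow> (nat \<Rightarrow> real) \<Rightarrow> 'a::{real_algebra_1, euclidean_space}"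
  assumes "\<And>i. i \<in> I \<Longrightarrow> hom_poly m k (F i)"
  shows "hom_poly m k (\<lambda>x. \<Sum>i\<in>I. F i x * c i)"
  using assms by (intro hom_poly_sum hom_poly_linear[OF _ linear_mult_const(1)])

text \<open>  The coefficients are those of \<open>F\<close> at the monomials without \<open>x 0\<close>, rescaled by factorials. With this choice
  both sides agree on the hyperplane \<open>x 0 = 0\<close>, and both are monogenic.\<close>

lemma fueter_expansion:
  assumes "hom_poly m k F" "monogenic w m F" "w 0 = 1"
  shows "\<exists>d. \<forall>x. F x = (\<Sum>\<kappa>\<in>multi_indices_of_degree {1..m} k. fueter w m (\<lambda>s. int (\<kappa> s)) x * d \<kappa>)"
proof -
  let ?I = "multi_indices_of_degree {1..m} k"
  from hom_poly_coefficients[OF assms(1)] obtain c where c: "\<forall>x. F x = (\<Sum>\<alpha>\<in>multi_indices_of_degree {0..m} k. (\<Prod>i=0..m. x i ^ \<alpha> i) *\<^sub>R c \<alpha>)"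
    by (elim exE)
  define d where "d \<kappa> = real (multi_fact {1..m} \<kappa>) *\<^sub>R c \<kappa>" for \<kappa>
  define G where "G x = (\<Sum>\<kappa>\<in>?I. fueter w m (\<lambda>s. int (\<kappa> s)) x * d \<kappa>)" for x
  have split: "sum g {0..m} = g 0 + sum g {1..m}" for g :: "nat \<Rightarrow> nat"
    by (simp add: sum.atLeast_Suc_atMost One_nat_def)
  have psplit: "prod g {0..m} = g 0 * prod g {1..m}" for g :: "nat \<Rightarrow> real"
    by (simp add: prod.atLeast_Suc_atMost One_nat_def)
  have mem: "s \<in> {1..m} \<longleftrightarrow> s \<in> {0..m} \<and> s \<noteq> 0" for s by auto
  have sub: "?I = {\<alpha> \<in> multi_indices_of_degree {0..m} k. \<alpha> 0 = 0}"
    by (auto simp: multi_indices_of_degree_def multi_indices_def split mem simp del: atLeastAtMost_iff)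
  have h: "hom_poly m k (fueter w m (\<lambda>s. int (\<kappa> s)))" if "\<kappa> \<in> ?I" for \<kappa>
    using that by (intro hom_poly_fueter) (auto simp: multi_indices_of_degree_def)
  have "F x = G x" if x: "x 0 = 0" for x
  proof -
    have "F x = (\<Sum>\<alpha>\<in>?I. (\<Prod>i=0..m. x i ^ \<alpha> i) *\<^sub>R c \<alpha>)"
      unfolding c[rule_format] sub
      by (intro sum.mono_neutral_right finite_multi_indices_of_degree) (auto simp: psplit x)
    also have "\<dots> = G x"
      unfolding G_def
    proof (rule sum.cong[OF refl])
      fix \<alpha> assume "\<alpha> \<in> ?I"
      then have "\<alpha> 0 = 0" by (simp add: sub)
      then have "(\<Prod>i=0..m. x i ^ \<alpha> i) *\<^sub>R c \<alpha> = of_real (\<Prod>i=1..m. x i ^ \<alpha> i) * c \<alpha>"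
        by (simp add: psplit of_real_def)
      also have "\<dots> = fueter w m (\<lambda>s. int (\<alpha> s)) x * d \<alpha>"
        unfolding fueter_on_hyperplane_0[where x = x and m = m and \<kappa> = \<alpha> and w = w, OF x, symmetric]
        by (simp add: d_def)
      finally show "(\<Prod>i=0..m. x i ^ \<alpha> i) *\<^sub>R c \<alpha> = fueter w m (\<lambda>s. int (\<alpha> s)) x * d \<alpha>" .
    qed
    finally show ?thesis .
  qed
  moreover have G: "hom_poly m k G" "monogenic w m G"
    unfolding G_def
    by (rule hom_poly_combination monogenic_combination monogenic_fueter h assms(3) | assumption)+
  ultimately have "F x - G x = 0" for x
    using monogenic_eq_0_if_0_on_hyperplane[where j = 0 and b = 1,
        OF hom_poly_diff[OF assms(1) G(1)] monogenic_diff[OF assms(1) G(1) assms(2) G(2)]] assms(3) by simp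
  then show ?thesis by (intro exI[of _ d] allI) (simp add: G_def)
qed

lemma pd_fueter_combination:
  assumes "s \<in> {1..m}"
  shows "pd s (\<lambda>x. \<Sum>i\<in>I. fueter w m (g i) x * a i) = (\<lambda>x. \<Sum>i\<in>I. fueter w m (decr s (g i)) x * a i)"
proof -
  have "pd s (\<lambda>x. \<Sum>i\<in>I. fueter w m (g i) x * a i) =
    (\<lambda>x. \<Sum>i\<in>I. pd s (\<lambda>x. fueter w m (g i) x * a i) x)"
    by (rule pd_sum[where m = m and k = "\<lambda>i. nat (\<Sum>s=1..m. g i s)"])
       (rule hom_poly_linear[OF hom_poly_fueter_nat linear_mult_const(1)])
  moreover have "pd s (\<lambda>x. fueter w m (g i) x * a i) = (\<lambda>x. fueter w m (decr s (g i)) x * a i)" for i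
    unfolding pd_linear[OF hom_poly_fueter_nat bounded_linear_mult_const(1)] pd_fueter[OF assms] ..
  ultimately show ?thesis by simp
qed

lemma pd_power_fueter_combination:
  assumes "s \<in> {1..m}"
  shows "(pd s ^^ j) (\<lambda>x. \<Sum>i\<in>I. fueter w m (g i) x * a i) =
    (\<lambda>x. \<Sum>i\<in>I. fueter w m ((g i)(s := g i s - int j)) x * a i)"
proof (induction j)
  case (Suc j)
  have decr: "decr s ((g i)(s := g i s - int j)) = (g i)(s := g i s - int (Suc j))" for i
    by (auto simp: decr_def fun_eq_iff)
  show ?case
    unfolding funpow.simps comp_def Suc pd_fueter_combination[OF assms] decr ..
qed simp

lemma pd_multi_fueter_combination:
  assumes "distinct xs" "set xs \<subseteq> {1..m}"
  shows "foldr (\<lambda>s. pd s ^^ h s) xs (\<lambda>x. \<Sum>i\<in>I. fueter w m (g i) x * a i) =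
    (\<lambda>x. \<Sum>i\<in>I. fueter w m (\<lambda>s. if s \<in> set xs then g i s - int (h s) else g i s) x * a i)"
  using assms
proof (induction xs)
  case (Cons u xs)
  have u: "u \<in> {1..m}" using Cons by simp
  have IH: "foldr (\<lambda>s. pd s ^^ h s) xs (\<lambda>x. \<Sum>i\<in>I. fueter w m (g i) x * a i) =
    (\<lambda>x. \<Sum>i\<in>I. fueter w m (\<lambda>s. if s \<in> set xs then g i s - int (h s) else g i s) x * a i)"
    using Cons by simp
  have idx: "(\<lambda>s. if s \<in> set xs then g i s - int (h s) else g i s)
      (u := (if u \<in> set xs then g i u - int (h u) else g i u) - int (h u)) =
    (\<lambda>s. if s \<in> set (u # xs) then g i s - int (h s) else g i s)" for i
    using Cons.prems by (auto simp: fun_eq_iff)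
  show ?case
    unfolding foldr.simps o_apply IH pd_power_fueter_combination[OF u] idx ..
qed simp

text \<open>  The iterated derivative turns the index \<open>\<mu>\<close> into \<open>\<mu> - \<kappa>\<close>, and at the origin only the polynomial with index
  zero survives.\<close>

lemma pd_multi_fueter_combination_at_0:
  assumes "finite I" "I \<subseteq> multi_indices {1..m}" "\<kappa> \<in> multi_indices {1..m}"
  shows "foldr (\<lambda>s. pd s ^^ \<kappa> s) [0..<Suc m]
      (\<lambda>x. \<Sum>\<mu>\<in>I. fueter w m (\<lambda>s. int (\<mu> s)) x * a \<mu>) (\<lambda>_. 0) = (if \<kappa> \<in> I then a \<kappa> else 0)"
proof -
  have index_0: "(\<forall>s\<in>{1..m}. int (\<mu> s) - int (\<kappa> s) = 0) \<longleftrightarrow> \<mu> = \<kappa>" if "\<mu> \<in> I" for \<mu>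
  proof
    assume eq: "\<forall>s\<in>{1..m}. int (\<mu> s) - int (\<kappa> s) = 0"
    have "\<mu> \<in> multi_indices {1..m}" using assms(2) that by blast
    with assms(3) have out: "\<mu> s = \<kappa> s" if "s \<notin> {1..m}" for s
      using that by (simp add: multi_indices_def)
    have "\<mu> s = \<kappa> s" for s
      using eq out[of s] by (cases "s \<in> {1..m}") auto
    then show "\<mu> = \<kappa>" by (rule ext)
  qed simp
  have 0: "[0..<Suc m] = 0 # [1..<Suc m]" by (simp add: upt_conv_Cons One_nat_def del: upt_Suc)
  have "\<kappa> 0 = 0" using assms(3) by (simp add: multi_indices_def)
  then have "foldr (\<lambda>s. pd s ^^ \<kappa> s) [0..<Suc m]
      (\<lambda>x. \<Sum>\<mu>\<in>I. fueter w m (\<lambda>s. int (\<mu> s)) x * a \<mu>) (\<lambda>_. 0) =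
    foldr (\<lambda>s. pd s ^^ \<kappa> s) [1..<Suc m]
      (\<lambda>x. \<Sum>\<mu>\<in>I. fueter w m (\<lambda>s. int (\<mu> s)) x * a \<mu>) (\<lambda>_. 0)"
    unfolding 0 by (simp del: upt_Suc)
  also have "\<dots> = (\<Sum>\<mu>\<in>I. fueter w m (\<lambda>s. if s \<in> set [1..<Suc m] then int (\<mu> s) - int (\<kappa> s) else int (\<mu> s)) (\<lambda>_. 0) * a \<mu>)"
    by (subst pd_multi_fueter_combination) (simp_all add: atLeastLessThanSuc_atLeastAtMost del: upt_Suc)
  also have "\<dots> = (\<Sum>\<mu>\<in>I. if \<kappa> = \<mu> then a \<mu> else 0)"
  proof (rule sum.cong[OF refl])
    fix \<mu> assume "\<mu> \<in> I"
    then show "fueter w m (\<lambda>s. if s \<in> set [1..<Suc m] then int (\<mu> s) - int (\<kappa> s) else int (\<mu> s)) (\<lambda>_. 0) * a \<mu> =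
      (if \<kappa> = \<mu> then a \<mu> else 0)"
      using index_0[of \<mu>] by (auto simp: fueter_at_0 atLeastLessThanSuc_atLeastAtMost simp del: upt_Suc)
  qed
  also have "\<dots> = (if \<kappa> \<in> I then a \<kappa> else 0)"
    using assms(1) by simp
  finally show ?thesis .
qed

section \<open>Hypercomplex bases and slices\<close>

lemma span_image_eq_range:
  assumes "finite S"
  shows "span (w ` S) = range (\<lambda>y. \<Sum>s\<in>S. y s *\<^sub>R w s)"
proof
  have "subspace (range (\<lambda>y. \<Sum>s\<in>S. y s *\<^sub>R w s))"
  proof (rule subspaceI)
    show "0 \<in> range (\<lambda>y. \<Sum>s\<in>S. y s *\<^sub>R w s)"
      by (rule range_eqI[of _ _ "\<lambda>_. 0"]) simp
  next
    fix x x' assume "x \<in> range (\<lambda>y. \<Sum>s\<in>S. y s *\<^sub>R w s)" "x' \<in> range (\<lambda>y. \<Sum>s\<in>S. y s *\<^sub>R w s)"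
    then obtain y y' where "x = (\<Sum>s\<in>S. y s *\<^sub>R w s)" "x' = (\<Sum>s\<in>S. y' s *\<^sub>R w s)"
      by (elim rangeE)
    then show "x + x' \<in> range (\<lambda>y. \<Sum>s\<in>S. y s *\<^sub>R w s)"
      by (intro range_eqI[of _ _ "\<lambda>s. y s + y' s"]) (simp add: scaleR_add_left sum.distrib)
  next
    fix c x assume "x \<in> range (\<lambda>y. \<Sum>s\<in>S. y s *\<^sub>R w s)"
    then obtain y where "x = (\<Sum>s\<in>S. y s *\<^sub>R w s)" by (elim rangeE)
    then show "c *\<^sub>R x \<in> range (\<lambda>y. \<Sum>s\<in>S. y s *\<^sub>R w s)"
      by (intro range_eqI[of _ _ "\<lambda>s. c * y s"]) (simp add: scaleR_sum_right)
  qed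
  moreover have "w ` S \<subseteq> range (\<lambda>y. \<Sum>s\<in>S. y s *\<^sub>R w s)"
  proof
    fix x assume "x \<in> w ` S"
    then obtain u where "u \<in> S" "x = w u" by blast
    then show "x \<in> range (\<lambda>y. \<Sum>s\<in>S. y s *\<^sub>R w s)"
      using assms by (intro range_eqI[of _ _ "\<lambda>s. if s = u then 1 else 0"])
        (simp add: if_distrib[of "\<lambda>c. c *\<^sub>R _"] cong: if_cong)
  qed
  ultimately show "span (w ` S) \<subseteq> range (\<lambda>y. \<Sum>s\<in>S. y s *\<^sub>R w s)"
    by (rule span_minimal[rotated])
  show "range (\<lambda>y. \<Sum>s\<in>S. y s *\<^sub>R w s) \<subseteq> span (w ` S)"
    by (rule image_subsetI) (intro span_sum span_scale span_base imageI)
qed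

lemma representation_combination:
  assumes "independent C" "v ` S \<subseteq> C" "inj_on v S" "L \<subseteq> S" "finite S" "s \<in> S"
  shows "representation C (\<Sum>i\<in>L. y i *\<^sub>R v i) (v s) = (if s \<in> L then y s else 0)"
proof -
  have vC: "v i \<in> C" if "i \<in> L" for i using assms that by blast
  have fin: "finite L" using assms finite_subset by blast
  have "representation C (\<Sum>i\<in>L. y i *\<^sub>R v i) = (\<lambda>b. \<Sum>i\<in>L. representation C (y i *\<^sub>R v i) b)"
    by (rule representation_sum[OF assms(1)]) (intro span_scale span_base vC)
  then have "representation C (\<Sum>i\<in>L. y i *\<^sub>R v i) (v s) = (\<Sum>i\<in>L. y i * representation C (v i) (v s))"
    using vC by (simp add: representation_scale assms span_base)
  also have "\<dots> = (\<Sum>i\<in>L. if i = s then y i else 0)"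
    using assms vC by (intro sum.cong refl) (auto simp: representation_basis inj_on_def)
  finally show ?thesis using fin by simp
qed

lemma representation_combination_outside:
  assumes "independent C" "v ` L \<subseteq> C" "b \<notin> v ` L"
  shows "representation C (\<Sum>i\<in>L. y i *\<^sub>R v i) b = 0"
proof -
  have "representation C (\<Sum>i\<in>L. y i *\<^sub>R v i) = (\<lambda>b. \<Sum>i\<in>L. representation C (y i *\<^sub>R v i) b)"
    by (rule representation_sum[OF assms(1)]) (use assms(2) in \<open>blast intro: span_scale span_base\<close>)
  moreover have "representation C (y i *\<^sub>R v i) b = 0" if "i \<in> L" for i
  proof -
    have "v i \<in> C" using assms that by blast
    then show ?thesis using assms that
      by (auto simp: representation_scale span_base representation_basis)
  qed
  ultimately show ?thesis by simp
qed

locale hypercomplex_setting =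
  fixes cj :: "'a::{real_algebra_1, euclidean_space} \<Rightarrow> 'a"
    and V B :: "'a set" and v :: "nat \<Rightarrow> 'a" and t :: "nat \<Rightarrow> nat" and n \<tau> :: nat
  assumes hypercomplex_basis: "hypercomplex_basis cj V n v"
    and completes_basis: "completes_basis B n v"
    and step_list: "step_list n \<tau> t"
begin

abbreviation "m \<equiv> t 0 + \<tau>"

abbreviation "block h \<equiv> {t (h - 1) + 1..t h}"

lemma inj_v: "inj_on v {0..n}"
  and V_eq: "V = span (v ` {0..n})"
  and independent_v: "independent (v ` {0..n})"
  and v_0: "v 0 = 1"
  using hypercomplex_basis by (auto simp: hypercomplex_basis_def)

lemma v_square: "s \<in> {1..n} \<Longrightarrow> v s * v s = - 1"
proof -
  assume "s \<in> {1..n}"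
  then have "v s \<in> imag_units cj" using hypercomplex_basis by (simp add: hypercomplex_basis_def)
  then have "v s + cj (v s) = 0" "v s * cj (v s) = 1"
    by (simp_all add: imag_units_def star_trace_def star_norm_def)
  then have "cj (v s) = - v s" by (simp add: add_eq_0_iff)
  with \<open>v s * cj (v s) = 1\<close> have "- (v s * v s) = 1" by simp
  then show "v s * v s = - 1" by (metis minus_minus)
qed

lemma v_anticommute: "s \<in> {1..n} \<Longrightarrow> u \<in> {1..n} \<Longrightarrow> s \<noteq> u \<Longrightarrow> v s * v u = - (v u * v s)"
  using hypercomplex_basis unfolding hypercomplex_basis_def by blast

lemma independent_B: "independent B" and v_B: "v ` {0..n} \<subseteq> B" and span_B: "span B = UNIV"
  using completes_basis by (auto simp: completes_basis_def)

lemma finite_B: "finite B"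
  using independent_B by (rule independent_imp_finite)

text \<open>  The mixed products cancel by anticommutativity.\<close>

lemma combination_square:
  "finite L \<Longrightarrow> L \<subseteq> {1..n} \<Longrightarrow>
    (\<Sum>l\<in>L. y l *\<^sub>R v l) * (\<Sum>l\<in>L. y l *\<^sub>R v l) = - of_real (\<Sum>l\<in>L. (y l)\<^sup>2)"
proof (induction L rule: finite_induct)
  case (insert i L)
  let ?S = "\<Sum>l\<in>L. y l *\<^sub>R v l"
  have "v i * v l = - (v l * v i)" if "l \<in> L" for l
    using insert that by (intro v_anticommute) auto
  then have "v i * ?S = - (?S * v i)"
    unfolding sum_distrib_left sum_distrib_right sum_negf[symmetric]
    by (intro sum.cong refl) simp
  moreover have "v i * v i = - 1" using insert by (intro v_square) auto
  ultimately show ?case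
    using insert by (simp add: algebra_simps power2_eq_square) (simp add: of_real_def)
qed simp

lemma combination_anticommute:
  assumes "L \<subseteq> {1..n}" "L' \<subseteq> {1..n}" "L \<inter> L' = {}"
  shows "(\<Sum>l\<in>L. y l *\<^sub>R v l) * (\<Sum>l\<in>L'. z l *\<^sub>R v l) = - ((\<Sum>l\<in>L'. z l *\<^sub>R v l) * (\<Sum>l\<in>L. y l *\<^sub>R v l))"
proof -
  have "(\<Sum>l\<in>L. y l *\<^sub>R v l) * (\<Sum>l\<in>L'. z l *\<^sub>R v l) = (\<Sum>l\<in>L. \<Sum>l'\<in>L'. - ((z l' *\<^sub>R v l') * (y l *\<^sub>R v l)))"
    unfolding sum_product
  proof (intro sum.cong refl)
    fix l l' assume "l \<in> L" "l' \<in> L'"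
    then have "v l * v l' = - (v l' * v l)" using assms by (intro v_anticommute) auto
    then show "y l *\<^sub>R v l * z l' *\<^sub>R v l' = - (z l' *\<^sub>R v l' * y l *\<^sub>R v l)" by simp
  qed
  also have "\<dots> = - ((\<Sum>l\<in>L'. z l *\<^sub>R v l) * (\<Sum>l\<in>L. y l *\<^sub>R v l))"
    unfolding sum_product sum_negf by (subst sum.swap) (rule refl)
  finally show ?thesis .
qed

lemma basis_norm_combination:
  assumes "L \<subseteq> {0..n}"
  shows "basis_norm B (\<Sum>l\<in>L. y l *\<^sub>R v l) = sqrt (\<Sum>l\<in>L. (y l)\<^sup>2)"
proof -
  let ?r = "representation B (\<Sum>l\<in>L. y l *\<^sub>R v l)"
  have vL: "v ` L \<subseteq> B" and inj: "inj_on v L" using assms v_B inj_v by (auto intro: inj_on_subset)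
  have "(\<Sum>b\<in>B. (?r b)\<^sup>2) = (\<Sum>b\<in>v ` L. (?r b)\<^sup>2)"
    by (rule sum.mono_neutral_right[OF finite_B vL])
       (auto simp: representation_combination_outside[OF independent_B vL])
  also have "\<dots> = (\<Sum>l\<in>L. (?r (v l))\<^sup>2)" using inj by (simp add: sum.reindex)
  also have "\<dots> = (\<Sum>l\<in>L. (y l)\<^sup>2)"
    using assms representation_combination[OF independent_B v_B inj_v assms, of _ y]
    by (intro sum.cong refl) (simp add: subset_iff)
  finally show ?thesis by (simp add: basis_norm_def L2_set_def)
qed

lemma t_less: "i < j \<Longrightarrow> j \<le> \<tau> \<Longrightarrow> t i < t j"
  using step_list by (auto simp: step_list_def strict_mono_on_def)

lemma t_le: "i \<le> j \<Longrightarrow> j \<le> \<tau> \<Longrightarrow> t i \<le> t j"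
  using t_less[of i j] by (cases "i = j") auto

lemma t_last: "t \<tau> = n"
  using step_list by (simp add: step_list_def)

lemma t_0_le_n: "t 0 \<le> n"
  using t_le[of 0 \<tau>] by (simp add: t_last)

lemma block_subset: "h \<in> {1..\<tau>} \<Longrightarrow> block h \<subseteq> {t 0 + 1..n}"
  using t_le[of 0 "h - 1"] t_le[of h \<tau>] by (auto simp: t_last)

lemma block_nonempty: "h \<in> {1..\<tau>} \<Longrightarrow> t h \<in> block h"
  using t_less[of "h - 1" h] by auto

lemma block_disjoint:
  assumes "h \<in> {1..\<tau>}" "h' \<in> {1..\<tau>}" "h \<noteq> h'"
  shows "block h \<inter> block h' = {}"
proof -
  have "block h \<inter> block h' = {}" if "h < h'" "h' \<in> {1..\<tau>}" for h h'
  proof -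
    have "h \<le> h' - 1" "h' - 1 \<le> \<tau>" using that by (simp_all add: One_nat_def)
    then show ?thesis using t_le[of h "h' - 1"] by auto
  qed
  from this[of h h'] this[of h' h] assms show ?thesis by (cases "h < h'") auto
qed

lemma sum_blocks:
  fixes g :: "nat \<Rightarrow> 'b::comm_monoid_add"
  shows "(\<Sum>i=t 0 + 1..n. g i) = (\<Sum>h=1..\<tau>. \<Sum>i\<in>block h. g i)"
proof -
  have "j \<le> \<tau> \<Longrightarrow> (\<Sum>i=t 0 + 1..t j. g i) = (\<Sum>h=1..j. \<Sum>i\<in>block h. g i)" for j
  proof (induction j)
    case (Suc j)
    have "t 0 \<le> t j" "t j < t (Suc j)" using t_le[of 0 j] t_less[of j "Suc j"] Suc by auto
    then have "{t 0 + 1..t (Suc j)} = {t 0 + 1..t j} \<union> block (Suc j)" by auto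
    moreover have "{t 0 + 1..t j} \<inter> block (Suc j) = {}" by auto
    ultimately have "(\<Sum>i=t 0 + 1..t (Suc j). g i) = (\<Sum>i=t 0 + 1..t j. g i) + (\<Sum>i\<in>block (Suc j). g i)"
      by (simp add: sum.union_disjoint)
    then show ?case using Suc by simp
  qed simp
  from this[of \<tau>] show ?thesis by (simp add: t_last)
qed

lemma sum_slice_indices:
  fixes g :: "nat \<Rightarrow> 'b::comm_monoid_add"
  shows "(\<Sum>s=0..m. g s) = (\<Sum>s=0..t 0. g s) + (\<Sum>h=1..\<tau>. g (t 0 + h))"
    and "(\<Sum>s=1..m. g s) = (\<Sum>s=1..t 0. g s) + (\<Sum>h=1..\<tau>. g (t 0 + h))"
    and "(\<Sum>s=t 0 + 1..m. g s) = (\<Sum>h=1..\<tau>. g (t 0 + h))"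
proof -
  have "{t 0 + 1..m} = (\<lambda>h. t 0 + h) ` {1..\<tau>}"
    by (simp add: image_add_atLeastAtMost)
  then show *: "(\<Sum>s=t 0 + 1..m. g s) = (\<Sum>h=1..\<tau>. g (t 0 + h))"
    by (simp only:) (subst sum.reindex, simp_all only: inj_on_add comp_def)
  have "{0..m} = {0..t 0} \<union> {t 0 + 1..m}" "{1..m} = {1..t 0} \<union> {t 0 + 1..m}" by auto
  then show "(\<Sum>s=0..m. g s) = (\<Sum>s=0..t 0. g s) + (\<Sum>h=1..\<tau>. g (t 0 + h))"
    "(\<Sum>s=1..m. g s) = (\<Sum>s=1..t 0. g s) + (\<Sum>h=1..\<tau>. g (t 0 + h))"
    by (simp_all add: sum.union_disjoint ivl_disj_int flip: *)
qed

text \<open>  Points of \<open>V\<close> and their coordinates. The coordinates are taken with respect to the basis \<open>B\<close> of the whole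
  algebra, which makes them linear, hence continuous, on the whole space.\<close>

definition comb :: "(nat \<Rightarrow> real) \<Rightarrow> 'a" where
  "comb x = (\<Sum>i=0..n. x i *\<^sub>R v i)"

definition crd :: "'a \<Rightarrow> nat \<Rightarrow> real" where
  "crd x i = representation B x (v i)"

lemma comb_cong: "(\<And>i. i \<le> n \<Longrightarrow> x i = y i) \<Longrightarrow> comb x = comb y"
  unfolding comb_def by (intro sum.cong refl) simp

lemma V_eq_range: "V = range comb"
  unfolding V_eq comb_def by (rule span_image_eq_range) simp

lemma comb_in_V: "comb x \<in> V"
  unfolding V_eq_range by (rule rangeI)

lemma crd_comb: "i \<le> n \<Longrightarrow> crd (comb x) i = x i"
  unfolding crd_def comb_def
  by (subst representation_combination[OF independent_B v_B inj_v]) auto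

lemma coord_comb: "i \<le> n \<Longrightarrow> coord n v (comb x) i = x i"
  unfolding coord_def comb_def
  by (subst representation_combination[OF independent_v subset_refl inj_v]) auto

lemma comb_crd: "x \<in> V \<Longrightarrow> comb (crd x) = x"
  unfolding V_eq_range by (elim rangeE) (simp add: crd_comb cong: comb_cong)

lemma continuous_on_crd: "continuous_on U (\<lambda>x. crd x i)"
proof -
  have "linear (\<lambda>x. crd x i)"
    unfolding crd_def using independent_B span_B
    by (auto intro!: linearI simp: representation_add representation_scale)
  then show ?thesis by (intro linear_continuous_on) (simp add: linear_conv_bounded_linear)
qed

lemma block_part_comb:
  assumes "h \<in> {1..\<tau>}"
  shows "block_part n v t (comb x) h = (\<Sum>l\<in>block h. x l *\<^sub>R v l)"
  unfolding block_part_def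
  using block_subset[OF assms] by (intro sum.cong refl) (auto simp: coord_comb subset_iff)

abbreviation "torus \<equiv> T_torus B v t \<tau>"

lemma block_subset_0_n: "h \<in> {1..\<tau>} \<Longrightarrow> block h \<subseteq> {0..n}"
  and block_subset_1_n: "h \<in> {1..\<tau>} \<Longrightarrow> block h \<subseteq> {1..n}"
  using block_subset[of h] by (auto simp: subset_iff)

lemma unit_sphere_intro:
  assumes "h \<in> {1..\<tau>}" "(\<Sum>l\<in>block h. (y l)\<^sup>2) = 1"
  shows "(\<Sum>l\<in>block h. y l *\<^sub>R v l) \<in> unit_sphere B v (t (h - 1) + 1) (t h)"
  unfolding unit_sphere_def mem_Collect_eq
    basis_norm_combination[OF block_subset_0_n[OF assms(1)]] assms(2)
  by (intro conjI span_sum span_scale span_base imageI) simp_all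

lemma unit_sphere_dest:
  assumes "h \<in> {1..\<tau>}" "j \<in> unit_sphere B v (t (h - 1) + 1) (t h)"
  shows "j = (\<Sum>l\<in>block h. crd j l *\<^sub>R v l)" "(\<Sum>l\<in>block h. (crd j l)\<^sup>2) = 1"
proof -
  have "j \<in> range (\<lambda>y. \<Sum>l\<in>block h. y l *\<^sub>R v l)"
    using assms(2) unfolding unit_sphere_def span_image_eq_range[OF finite_atLeastAtMost] by simp
  then obtain y where y: "j = (\<Sum>l\<in>block h. y l *\<^sub>R v l)" by (elim rangeE)
  have crd_j: "crd j l = y l" if "l \<in> block h" for l
    unfolding crd_def y using that block_subset_0_n[OF assms(1)]
    by (subst representation_combination[OF independent_B v_B inj_v]) auto
  show "j = (\<Sum>l\<in>block h. crd j l *\<^sub>R v l)"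
    by (rule trans[OF y], intro sum.cong refl) (simp only: crd_j)
  moreover have "basis_norm B j = 1" using assms(2) by (simp add: unit_sphere_def)
  ultimately show "(\<Sum>l\<in>block h. (crd j l)\<^sup>2) = 1"
    using basis_norm_combination[OF block_subset_0_n[OF assms(1)], of "crd j"] by simp
qed

lemma torus_component:
  assumes "J \<in> torus" "h \<in> {1..\<tau>}"
  shows "J h = (\<Sum>l\<in>block h. crd (J h) l *\<^sub>R v l)" "(\<Sum>l\<in>block h. (crd (J h) l)\<^sup>2) = 1"
  using assms unit_sphere_dest[OF assms(2), of "J h"] by (auto simp: T_torus_def PiE_iff)

lemma torus_square:
  assumes "J \<in> torus" "h \<in> {1..\<tau>}"
  shows "J h * J h = - 1"
  using combination_square[OF finite_atLeastAtMost block_subset_1_n[OF assms(2)], of "crd (J h)"]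
  unfolding torus_component(1)[OF assms, symmetric] torus_component(2)[OF assms] of_real_1 .

lemma torus_anticommute:
  assumes "J \<in> torus" "h \<in> {1..\<tau>}" "h' \<in> {1..\<tau>}" "h \<noteq> h'"
  shows "J h * J h' = - (J h' * J h)"
  using combination_anticommute[OF block_subset_1_n block_subset_1_n block_disjoint, of h h' "crd (J h)" "crd (J h')"]
    assms by (simp add: torus_component(1)[OF assms(1), symmetric])

lemma torus_v_anticommute:
  assumes "J \<in> torus" "h \<in> {1..\<tau>}" "s \<in> {1..t 0}"
  shows "J h * v s = - (v s * J h)"
proof -
  have "{s} \<subseteq> {1..n}" "block h \<inter> {s} = {}"
    using assms t_0_le_n block_subset[OF assms(2)] by auto
  from combination_anticommute[OF block_subset_1_n[OF assms(2)] this, of "crd (J h)" "\<lambda>_. 1"]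
  show ?thesis by (simp add: torus_component(1)[OF assms(1,2), symmetric])
qed

lemma torus_nonempty: "torus \<noteq> {}"
proof -
  have "v (t h) \<in> unit_sphere B v (t (h - 1) + 1) (t h)" if h: "h \<in> {1..\<tau>}" for h
    using unit_sphere_intro[OF h, of "\<lambda>l. if l = t h then 1 else 0"] block_nonempty[OF h]
    by (simp add: if_distrib[of "\<lambda>c. c *\<^sub>R _"] if_distrib[of "\<lambda>c. c ^ _"] cong: if_cong)
  then have "(\<lambda>h\<in>{1..\<tau>}. v (t h)) \<in> torus" by (auto simp: T_torus_def)
  then show ?thesis by blast
qed

definition slice :: "(nat \<Rightarrow> 'a) \<Rightarrow> (nat \<Rightarrow> real) \<Rightarrow> 'a" where
  "slice J x = (\<Sum>s=0..m. x s *\<^sub>R adapted_basis v t J s)"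

lemma slice_cong: "(\<And>s. s \<le> m \<Longrightarrow> x s = y s) \<Longrightarrow> slice J x = slice J y"
  unfolding slice_def by (intro sum.cong refl) simp

lemma slice_eq: "slice J x = (\<Sum>s=0..t 0. x s *\<^sub>R v s) + (\<Sum>h=1..\<tau>. x (t 0 + h) *\<^sub>R J h)"
  unfolding slice_def sum_slice_indices
  by (intro arg_cong2[where f = "(+)"] sum.cong refl) (auto simp: adapted_basis_def)

lemma adapted_basis_simps [simp]:
  "s \<le> t 0 \<Longrightarrow> adapted_basis v t J s = v s"
  "1 \<le> h \<Longrightarrow> adapted_basis v t J (t 0 + h) = J h"
  by (auto simp: adapted_basis_def)

lemma adapted_space_eq_range: "adapted_space v t \<tau> J = range (slice J)"
  unfolding adapted_space_def slice_def by (rule span_image_eq_range) simp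

definition block_index :: "nat \<Rightarrow> nat" where
  "block_index i = (SOME h. h \<in> {1..\<tau>} \<and> i \<in> block h)"

lemma block_index_eq:
  assumes "h \<in> {1..\<tau>}" "i \<in> block h"
  shows "block_index i = h"
proof -
  have "block_index i \<in> {1..\<tau>} \<and> i \<in> block (block_index i)"
    unfolding block_index_def by (rule someI[of _ h]) (use assms in simp)
  then show ?thesis using block_disjoint[of "block_index i" h] assms by blast
qed

text \<open>  The coordinates with respect to \<open>v\<close> of the point of a slice with slice coordinates \<open>x\<close>.\<close>

definition slice_coeff :: "(nat \<Rightarrow> 'a) \<Rightarrow> (nat \<Rightarrow> real) \<Rightarrow> nat \<Rightarrow> real" where
  "slice_coeff J x i = (if i \<le> t 0 then x i else crd (J (block_index i)) i * x (t 0 + block_index i))"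

lemma slice_coeff_block:
  assumes "h \<in> {1..\<tau>}" "i \<in> block h"
  shows "slice_coeff J x i = crd (J h) i * x (t 0 + h)"
  using block_index_eq[OF assms] block_subset[OF assms(1)] assms(2) by (auto simp: slice_coeff_def)

lemma sum_comb_indices:
  fixes g :: "nat \<Rightarrow> 'b::comm_monoid_add"
  shows "(\<Sum>i=0..n. g i) = (\<Sum>s=0..t 0. g s) + (\<Sum>h=1..\<tau>. \<Sum>i\<in>block h. g i)"
proof -
  have "{0..n} = {0..t 0} \<union> {t 0 + 1..n}" using t_0_le_n by auto
  then show ?thesis by (simp add: sum.union_disjoint ivl_disj_int flip: sum_blocks)
qed

lemma slice_coeff_block_sum:
  assumes "J \<in> torus" "h \<in> {1..\<tau>}"
  shows "(\<Sum>i\<in>block h. slice_coeff J x i *\<^sub>R v i) = x (t 0 + h) *\<^sub>R J h"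
proof -
  have "(\<Sum>i\<in>block h. slice_coeff J x i *\<^sub>R v i) = (\<Sum>i\<in>block h. x (t 0 + h) *\<^sub>R (crd (J h) i *\<^sub>R v i))"
    using assms(2) by (intro sum.cong refl) (simp add: slice_coeff_block mult.commute)
  also have "\<dots> = x (t 0 + h) *\<^sub>R J h"
    by (simp only: torus_component(1)[OF assms, symmetric] flip: scaleR_sum_right)
  finally show ?thesis .
qed

lemma slice_eq_comb:
  assumes "J \<in> torus"
  shows "slice J x = comb (slice_coeff J x)"
  unfolding slice_eq comb_def sum_comb_indices
  by (intro arg_cong2[where f = "(+)"] sum.cong refl)
     (simp add: slice_coeff_def, simp add: slice_coeff_block_sum[OF assms])

lemma slice_in_V: "J \<in> torus \<Longrightarrow> slice J x \<in> V"
  by (simp add: slice_eq_comb comb_in_V)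

lemma V_inter_adapted_space: "J \<in> torus \<Longrightarrow> V \<inter> adapted_space v t \<tau> J = range (slice J)"
  using slice_in_V by (auto simp: adapted_space_eq_range)

text \<open>  A continuous left inverse of \<open>slice J\<close>: since the coordinates of \<open>J h\<close> have square sum \<open>1\<close>, the coordinate of
  a point along \<open>J h\<close> is the Euclidean inner product of its block with \<open>J h\<close>.\<close>

definition slice_crd :: "(nat \<Rightarrow> 'a) \<Rightarrow> 'a \<Rightarrow> nat \<Rightarrow> real" where
  "slice_crd J y s = (if s \<le> t 0 then crd y s else \<Sum>l\<in>block (s - t 0). crd (J (s - t 0)) l * crd y l)"

lemma slice_crd_slice:
  assumes "J \<in> torus" "s \<le> m"
  shows "slice_crd J (slice J x) s = x s"
proof (cases "s \<le> t 0")
  case True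
  then show ?thesis
    using t_0_le_n by (simp add: slice_crd_def slice_eq_comb[OF assms(1)] crd_comb slice_coeff_def)
next
  case False
  define h where "h = s - t 0"
  have h: "h \<in> {1..\<tau>}" "s = t 0 + h" using False assms(2) by (auto simp: h_def)
  have "slice_crd J (slice J x) s = (\<Sum>l\<in>block h. crd (J h) l * slice_coeff J x l)"
    using False block_subset_0_n[OF h(1)]
    by (auto simp: slice_crd_def h_def slice_eq_comb[OF assms(1)] crd_comb subset_iff intro!: sum.cong)
  also have "\<dots> = (\<Sum>l\<in>block h. (crd (J h) l)\<^sup>2) * x s"
    unfolding sum_distrib_right
    using h by (intro sum.cong refl) (simp add: slice_coeff_block power2_eq_square)
  finally show ?thesis by (simp add: torus_component(2)[OF assms(1) h(1)])
qed

lemma slice_slice_crd: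
  assumes "J \<in> torus"
  shows "slice J (slice_crd J (slice J x)) = slice J x"
  by (rule slice_cong) (rule slice_crd_slice[OF assms])

lemma continuous_on_slice_crd: "continuous_on U (\<lambda>y. slice_crd J y s)"
  unfolding slice_crd_def
  by (cases "s \<le> t 0") (auto intro!: continuous_intros continuous_on_crd)

lemma slice_upd:
  assumes "s \<le> m"
  shows "slice J (x(s := x s + r)) = slice J x + r *\<^sub>R adapted_basis v t J s"
proof -
  have "finite I \<Longrightarrow> s \<in> I \<Longrightarrow> (\<Sum>u\<in>I. (x(s := x s + r)) u *\<^sub>R adapted_basis v t J u) =
    (\<Sum>u\<in>I. x u *\<^sub>R adapted_basis v t J u) + r *\<^sub>R adapted_basis v t J s" for I
    by (simp add: sum.remove[of I s] algebra_simps)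
  from this[of "{0..m}"] assms show ?thesis by (simp add: slice_def)
qed

lemma partial_deriv_slice:
  assumes "s \<le> m"
  shows "partial_deriv (adapted_basis v t J s) f (slice J x) = pd s (\<lambda>x. f (slice J x)) x"
  unfolding partial_deriv_def pd_def slice_upd[OF assms] ..

section \<open>Regular homogeneous polynomials on slices\<close>

lemma U_module_hom_poly:
  assumes "f \<in> U_module B n v t \<tau> k"
  shows "hom_poly n k (\<lambda>x. f (comb x))"
proof -
  from assms obtain c where c: "\<forall>x. f (comb x) =
      (\<Sum>\<alpha>\<in>multi_indices_of_degree {0..n} k. (\<Prod>i=0..n. x i ^ \<alpha> i) *\<^sub>R c \<alpha>)"
    unfolding U_module_def homogeneous_polynomial_map_def comb_def mem_Collect_eq
    by (elim conjE exE)
  show ?thesis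
    unfolding c[rule_format] by (rule hom_poly_of_coefficients)
qed

lemma U_module_slice:
  assumes "f \<in> U_module B n v t \<tau> k" "J \<in> torus"
  shows "hom_poly m k (\<lambda>x. f (slice J x))"
    and "monogenic (adapted_basis v t J) m (\<lambda>x. f (slice J x))"
proof -
  from U_module_hom_poly[OF assms(1)]
  have "hom_poly m k (\<lambda>x. f (comb (slice_coeff J x)))"
  proof (rule hom_poly_substitute)
    fix i assume "i \<le> n"
    show "\<exists>j\<le>m. \<exists>a. \<forall>x. slice_coeff J x i = a * x j"
    proof (cases "i \<le> t 0")
      case True
      then show ?thesis by (intro exI[of _ i] conjI exI[of _ 1]) (auto simp: slice_coeff_def)
    next
      case False
      have "i \<in> (\<Union>h\<in>{1..\<tau>}. block h)"
      proof (rule ccontr)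
        assume "i \<notin> (\<Union>h\<in>{1..\<tau>}. block h)"
        then have "(\<Sum>h=1..\<tau>. \<Sum>j\<in>block h. if j = i then 1 else 0 :: nat) = 0"
          by (intro sum.neutral ballI) auto
        moreover have "(\<Sum>j=t 0 + 1..n. if j = i then 1 else 0 :: nat) = 1"
          using False \<open>i \<le> n\<close> by simp
        ultimately show False unfolding sum_blocks by simp
      qed
      then obtain h where h: "h \<in> {1..\<tau>}" "i \<in> block h" by blast
      then show ?thesis
        by (intro exI[of _ "t 0 + h"] conjI exI[of _ "crd (J h) i"] allI slice_coeff_block) auto
    qed
  qed
  then show "hom_poly m k (\<lambda>x. f (slice J x))" by (simp add: slice_eq_comb[OF assms(2)])
  have "J_monogenic (adapted_basis v t J) m (range (slice J)) f"
    using assms unfolding V_inter_adapted_space[OF assms(2), symmetric]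
    by (simp add: U_module_def T_regular_def flip: V_eq)
  then have "(\<Sum>s=0..m. adapted_basis v t J s * partial_deriv (adapted_basis v t J s) f (slice J x)) = 0" for x
    by (simp add: J_monogenic_def)
  then show "monogenic (adapted_basis v t J) m (\<lambda>x. f (slice J x))"
    by (simp add: monogenic_def partial_deriv_slice)
qed

text \<open>  For polynomials the requirement of continuous differentiability is automatic; continuity of the partial
  derivatives on the slice follows by writing them in the slice coordinates.\<close>

lemma U_module_intro:
  assumes "f \<in> extensional V" "hom_poly n k (\<lambda>x. f (comb x))"
    and "\<And>J. J \<in> torus \<Longrightarrow> hom_poly m k (\<lambda>x. f (slice J x))"
    and "\<And>J. J \<in> torus \<Longrightarrow> monogenic (adapted_basis v t J) m (\<lambda>x. f (slice J x))"
  shows "f \<in> U_module B n v t \<tau> k"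
proof -
  have "J_monogenic (adapted_basis v t J) m (range (slice J)) f" if J: "J \<in> torus" for J
    unfolding J_monogenic_def C1_along_def
  proof (intro conjI ballI)
    fix s y assume s: "s \<in> {0..m}" and "y \<in> range (slice J)"
    then obtain x where y: "y = slice J x" by (elim rangeE)
    have "((\<lambda>r. f (slice J (x(s := x s + r)))) has_vector_derivative pd s (\<lambda>x. f (slice J x)) x) (at 0)"
      using hom_poly_has_pd[OF assms(3)[OF J]] .
    then show "(\<lambda>r. f (y + r *\<^sub>R adapted_basis v t J s)) differentiable at 0"
      using s by (simp add: slice_upd y differentiableI_vector)
  next
    fix s assume s: "s \<in> {0..m}"
    let ?G = "pd s (\<lambda>x. f (slice J x))"
    have "continuous_on (range (slice J)) (\<lambda>y. ?G (slice_crd J y))"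
      using hom_poly_pd[OF assms(3)[OF J]] by (rule hom_poly_continuous) (rule continuous_on_slice_crd)
    moreover have "partial_deriv (adapted_basis v t J s) f y = ?G (slice_crd J y)" if "y \<in> range (slice J)" for y
    proof -
      from that obtain x where y: "y = slice J x" by (elim rangeE)
      show ?thesis
        using partial_deriv_slice[of s J f "slice_crd J y"] s by (simp add: y slice_slice_crd[OF J])
    qed
    ultimately show "continuous_on (range (slice J)) (partial_deriv (adapted_basis v t J s) f)"
      by (simp cong: continuous_on_cong)
  next
    fix y assume "y \<in> range (slice J)"
    then obtain x where y: "y = slice J x" by (elim rangeE)
    show "(\<Sum>s=0..m. adapted_basis v t J s * partial_deriv (adapted_basis v t J s) f y) = 0"
      using assms(4)[OF J] by (simp add: y partial_deriv_slice monogenic_def)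
  qed
  moreover have "homogeneous_polynomial_map n v k f"
    using hom_poly_coefficients[OF assms(2)] by (simp add: homogeneous_polynomial_map_def comb_def)
  ultimately show ?thesis
    using assms(1) V_inter_adapted_space
    by (simp add: U_module_def T_regular_def flip: V_eq)
qed

end

section \<open>Products of powers of anticommuting units\<close>

lemma prod_list_rev_Suc:
  "prod_list (map g (rev [1..<Suc (Suc N)])) = g (Suc N) * prod_list (map g (rev [1..<Suc N]))"
  by (simp add: One_nat_def)

lemma power_anticommute:
  fixes x y :: "'a::real_algebra_1"
  assumes "x * y = - (y * x)"
  shows "x ^ e * y = (-1) ^ e *\<^sub>R (y * x ^ e)"
proof (induction e)
  case (Suc e)
  have "x ^ Suc e * y = x * (x ^ e * y)" by (simp add: mult.assoc)
  also have "\<dots> = (-1) ^ e *\<^sub>R ((x * y) * x ^ e)" by (simp add: Suc mult.assoc)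
  finally show ?case by (simp add: assms mult.assoc)
qed simp

text \<open>  Moving \<open>x\<close> through the product changes the sign once for every factor \<open>g i\<close> with \<open>i \<noteq> h\<close>. The choice \<open>h = 0\<close>
  covers an \<open>x\<close> that anticommutes with all factors.\<close>

lemma unit_product_anticommute:
  fixes x :: "'a::real_algebra_1"
  assumes "\<And>i. i \<in> {1..N} \<Longrightarrow> i \<noteq> h \<Longrightarrow> g i * x = - (x * g i)"
    and "h \<in> {1..N} \<Longrightarrow> g h * x = x * g h"
  shows "prod_list (map (\<lambda>i. g i ^ e i) (rev [1..<Suc N])) * x =
    (-1) ^ (\<Sum>i\<in>{1..N} - {h}. e i) *\<^sub>R (x * prod_list (map (\<lambda>i. g i ^ e i) (rev [1..<Suc N])))"
  using assms
proof (induction N)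
  case 0
  then show ?case by (simp add: One_nat_def)
next
  case (Suc N)
  let ?P = "prod_list (map (\<lambda>i. g i ^ e i) (rev [1..<Suc N]))"
  let ?a = "\<Sum>i\<in>{1..N} - {h}. e i"
  have IH: "?P * x = (-1) ^ ?a *\<^sub>R (x * ?P)" using Suc by auto
  have "g (Suc N) ^ e (Suc N) * ?P * x = (-1) ^ ?a *\<^sub>R (g (Suc N) ^ e (Suc N) * x * ?P)"
    by (simp add: mult.assoc IH del: upt_Suc)
  also have "\<dots> = (-1) ^ (\<Sum>i\<in>{1..Suc N} - {h}. e i) *\<^sub>R (x * (g (Suc N) ^ e (Suc N) * ?P))"
  proof (cases "Suc N = h")
    case True
    then have "{1..Suc N} - {h} = {1..N} - {h}" by auto
    moreover have "g (Suc N) ^ e (Suc N) * x = x * g (Suc N) ^ e (Suc N)"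
      using Suc.prems(2) True by (intro power_commuting_commutes) (simp add: One_nat_def)
    ultimately show ?thesis by (simp add: mult.assoc[symmetric] del: upt_Suc)
  next
    case False
    then have "{1..Suc N} - {h} = insert (Suc N) ({1..N} - {h})" by (auto simp: One_nat_def)
    moreover have "g (Suc N) ^ e (Suc N) * x = (-1) ^ e (Suc N) *\<^sub>R (x * g (Suc N) ^ e (Suc N))"
      using Suc.prems(1) False by (intro power_anticommute) (simp add: One_nat_def)
    ultimately show ?thesis
      by (simp add: mult.assoc[symmetric] power_add mult.commute[of "(-1) ^ e (Suc N)"] del: upt_Suc)
  qed
  finally show ?case unfolding prod_list_rev_Suc .
qed

text \<open>  One factor \<open>g h\<close> is moved to the front past the factors with larger index.\<close>

lemma unit_product_split:
  fixes g :: "nat \<Rightarrow> 'a::real_algebra_1"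
  assumes "\<And>i. i \<in> {1..N} \<Longrightarrow> i \<noteq> h \<Longrightarrow> g i * g h = - (g h * g i)"
    and "h \<in> {1..N}" "e h \<noteq> 0"
  shows "prod_list (map (\<lambda>i. g i ^ e i) (rev [1..<Suc N])) =
    (-1) ^ (\<Sum>i=h + 1..N. e i) *\<^sub>R
      (g h * prod_list (map (\<lambda>i. g i ^ (e(h := e h - 1)) i) (rev [1..<Suc N])))"
  using assms
proof (induction N)
  case 0
  then show ?case by simp
next
  case (Suc N)
  let ?e' = "e(h := e h - 1)"
  let ?P = "prod_list (map (\<lambda>i. g i ^ e i) (rev [1..<Suc N]))"
  let ?P' = "prod_list (map (\<lambda>i. g i ^ ?e' i) (rev [1..<Suc N]))"
  have "g (Suc N) ^ e (Suc N) * ?P =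
    (-1) ^ (\<Sum>i=h + 1..Suc N. e i) *\<^sub>R (g h * (g (Suc N) ^ ?e' (Suc N) * ?P'))"
  proof (cases "h = Suc N")
    case True
    have "?P = ?P'"
      using True by (intro arg_cong[of _ _ prod_list] map_cong refl) auto
    moreover have "g h ^ e h = g h * g h ^ (e h - 1)" using Suc.prems(3) by (simp add: power_eq_if)
    ultimately show ?thesis using True by (simp add: mult.assoc del: upt_Suc)
  next
    case False
    then have IH: "?P = (-1) ^ (\<Sum>i=h + 1..N. e i) *\<^sub>R (g h * ?P')"
      using Suc.prems by (intro Suc.IH) auto
    have "g (Suc N) ^ e (Suc N) * g h = (-1) ^ e (Suc N) *\<^sub>R (g h * g (Suc N) ^ e (Suc N))"
      using Suc.prems(1) False by (intro power_anticommute) (simp add: One_nat_def)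
    then have "g (Suc N) ^ e (Suc N) * (g h * ?P') =
        (-1) ^ e (Suc N) *\<^sub>R (g h * (g (Suc N) ^ e (Suc N) * ?P'))"
      by (simp add: mult.assoc[symmetric] del: upt_Suc)
    moreover have "(\<Sum>i=h + 1..Suc N. e i) = (\<Sum>i=h + 1..N. e i) + e (Suc N)"
      using False Suc.prems(2) by simp
    ultimately show ?thesis using False unfolding IH by (simp add: power_add del: upt_Suc)
  qed
  then show ?case unfolding prod_list_rev_Suc .
qed

lemma unit_product_invertible:
  fixes g :: "nat \<Rightarrow> 'a::real_algebra_1"
  assumes "\<And>i. i \<in> {1..N} \<Longrightarrow> g i * g i = - 1"
  shows "\<exists>b. prod_list (map (\<lambda>i. g i ^ e i) (rev [1..<Suc N])) * b = 1 \<and>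
    b * prod_list (map (\<lambda>i. g i ^ e i) (rev [1..<Suc N])) = 1"
  using assms
proof (induction N)
  case 0
  then show ?case by (simp add: One_nat_def)
next
  case (Suc N)
  let ?P = "prod_list (map (\<lambda>i. g i ^ e i) (rev [1..<Suc N]))"
  obtain b where b: "?P * b = 1" "b * ?P = 1" using Suc by auto
  have inv: "g (Suc N) * - g (Suc N) = 1" "- g (Suc N) * g (Suc N) = 1"
    using Suc.prems[of "Suc N"] by (simp_all add: One_nat_def)
  let ?q = "g (Suc N) ^ e (Suc N)" and ?r = "(- g (Suc N)) ^ e (Suc N)"
  have qr: "?q * ?r = 1" "?r * ?q = 1"
    using inv left_right_inverse_power[of _ _ "e (Suc N)"] by blast+
  have "(?q * ?P) * (b * ?r) = ?q * (?P * b) * ?r" by (simp only: mult.assoc)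
  moreover have "(b * ?r) * (?q * ?P) = b * (?r * ?q) * ?P" by (simp only: mult.assoc)
  ultimately have "(?q * ?P) * (b * ?r) = 1 \<and> (b * ?r) * (?q * ?P) = 1"
    by (simp add: b qr del: upt_Suc)
  then show ?case unfolding prod_list_rev_Suc by (rule exI[where x = "b * ?r"])
qed

lemma mult_inverse_mult:
  fixes a :: "'a::ring_1"
  assumes "\<exists>b. a * b = 1 \<and> b * a = 1"
  shows "mult_inverse a * a = 1" "a * mult_inverse a = 1"
proof -
  from assms obtain b where b: "a * b = 1" "b * a = 1" by blast
  have "mult_inverse a = b"
    unfolding mult_inverse_def
  proof (rule the_equality)
    fix c assume "a * c = 1 \<and> c * a = 1"
    then have "c * (a * b) = b" by (simp flip: mult.assoc)
    then show "c = b" by (simp add: b)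
  qed (use b in simp)
  then show "mult_inverse a * a = 1" "a * mult_inverse a = 1" by (simp_all add: b)
qed

section \<open>The polynomials on slices\<close>

context hypercomplex_setting
begin

text \<open>  The product whose inverse occurs in the adapted derivative.\<close>

definition unit_power :: "(nat \<Rightarrow> 'a) \<Rightarrow> (nat \<Rightarrow> nat) \<Rightarrow> 'a" where
  "unit_power J \<kappa> = prod_list (map (\<lambda>i. J i ^ \<kappa> (t 0 + i)) (rev [1..<Suc \<tau>]))"

lemma unit_power_inverse:
  assumes "J \<in> torus"
  shows "mult_inverse (unit_power J \<kappa>) * unit_power J \<kappa> = 1"
    and "unit_power J \<kappa> * mult_inverse (unit_power J \<kappa>) = 1"
  using mult_inverse_mult[OF unit_product_invertible[of \<tau> J "\<lambda>i. \<kappa> (t 0 + i)"]] torus_square[OF assms]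
  by (simp_all only: unit_power_def)

lemma unit_power_v:
  assumes "J \<in> torus" "s \<in> {1..t 0}"
  shows "unit_power J \<kappa> * v s = (-1) ^ (\<Sum>u=t 0 + 1..m. \<kappa> u) *\<^sub>R (v s * unit_power J \<kappa>)"
proof -
  have "{1..\<tau>} - {0} = {1..\<tau>}" by auto
  moreover have "unit_power J \<kappa> * v s = (-1) ^ (\<Sum>i\<in>{1..\<tau>} - {0}. \<kappa> (t 0 + i)) *\<^sub>R (v s * unit_power J \<kappa>)"
    unfolding unit_power_def
    by (rule unit_product_anticommute) (use torus_v_anticommute[OF assms(1) _ assms(2)] in auto)
  ultimately show ?thesis by (simp only: sum_slice_indices)
qed

lemma unit_power_component:
  assumes "J \<in> torus" "h \<in> {1..\<tau>}"
  shows "J h * unit_power J (\<kappa>(t 0 + h := e)) =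
    (-1) ^ ((\<Sum>u=t 0 + 1..m. \<kappa> u) - \<kappa> (t 0 + h)) *\<^sub>R (unit_power J (\<kappa>(t 0 + h := e)) * J h)"
proof -
  let ?\<kappa>' = "\<kappa>(t 0 + h := e)"
  have "unit_power J ?\<kappa>' * J h = (-1) ^ (\<Sum>i\<in>{1..\<tau>} - {h}. ?\<kappa>' (t 0 + i)) *\<^sub>R (J h * unit_power J ?\<kappa>')"
    unfolding unit_power_def
    by (rule unit_product_anticommute) (use torus_anticommute[OF assms(1) _ assms(2)] in auto)
  also have "(\<Sum>i\<in>{1..\<tau>} - {h}. ?\<kappa>' (t 0 + i)) = (\<Sum>i\<in>{1..\<tau>} - {h}. \<kappa> (t 0 + i))"
    by (intro sum.cong refl) auto
  also have "\<dots> = (\<Sum>u=t 0 + 1..m. \<kappa> u) - \<kappa> (t 0 + h)"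
    using assms(2) unfolding sum_slice_indices by (subst sum_diff1_nat) auto
  finally have "unit_power J ?\<kappa>' * J h =
    (-1) ^ ((\<Sum>u=t 0 + 1..m. \<kappa> u) - \<kappa> (t 0 + h)) *\<^sub>R (J h * unit_power J ?\<kappa>')" .
  moreover have "(-1::real) ^ a * (-1) ^ a = 1" for a
    by (simp flip: power_add mult_2)
  ultimately show ?thesis by (simp only: scaleR_scaleR scaleR_one)
qed

lemma unit_power_split:
  assumes "J \<in> torus" "h \<in> {1..\<tau>}" "\<kappa> (t 0 + h) \<noteq> 0"
  shows "unit_power J \<kappa> = (-1) ^ (\<Sum>u=t 0 + h + 1..m. \<kappa> u) *\<^sub>R
    (J h * unit_power J (\<kappa>(t 0 + h := \<kappa> (t 0 + h) - 1)))"
proof -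
  let ?e = "\<lambda>i. \<kappa> (t 0 + i)"
  have "unit_power J \<kappa> = (-1) ^ (\<Sum>i=h + 1..\<tau>. ?e i) *\<^sub>R
      (J h * prod_list (map (\<lambda>i. J i ^ (?e(h := ?e h - 1)) i) (rev [1..<Suc \<tau>])))"
    unfolding unit_power_def
    by (rule unit_product_split) (use torus_anticommute[OF assms(1) _ assms(2)] assms in auto)
  moreover have "?e(h := ?e h - 1) = (\<lambda>i. (\<kappa>(t 0 + h := \<kappa> (t 0 + h) - 1)) (t 0 + i))"
    by auto
  moreover have "(\<Sum>u=t 0 + h + 1..m. \<kappa> u) = (\<Sum>i=h + 1..\<tau>. ?e i)"
    using sum.shift_bounds_cl_nat_ivl[of \<kappa> "h + 1" "t 0" \<tau>] by (simp add: ac_simps)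
  ultimately show ?thesis by (simp only: unit_power_def)
qed

text \<open>  Without the division by the degree the recursion holds for all multi-indices, and the terms with a zero
  entry need no guard.\<close>

lemma T_poly_rec_scaled:
  "real (\<Sum>s=1..m. \<kappa> s) *\<^sub>R T_poly_rec n v t \<tau> \<kappa> x =
    (\<Sum>s=1..t 0. real (\<kappa> s) *\<^sub>R (T_poly_rec n v t \<tau> (\<kappa>(s := \<kappa> s - 1)) x *
       (of_real (coord n v x s) - ((-1) ^ (\<Sum>u=t 0 + 1..m. \<kappa> u) * coord n v x 0) *\<^sub>R v s))) +
    (\<Sum>h=1..\<tau>. ((-1) ^ (\<Sum>u=t 0 + h + 1..m. \<kappa> u) * real (\<kappa> (t 0 + h))) *\<^sub>R
       (T_poly_rec n v t \<tau> (\<kappa>(t 0 + h := \<kappa> (t 0 + h) - 1)) x *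
       (of_real (coord n v x 0) +
         (-1) ^ ((\<Sum>u=t 0 + 1..m. \<kappa> u) - \<kappa> (t 0 + h)) *\<^sub>R block_part n v t x h)))"
    (is "_ = ?A + ?B")
proof (cases "(\<Sum>s=1..m. \<kappa> s) = 0")
  case True
  then have "\<kappa> s = 0" if "s \<in> {1..m}" for s using that by simp
  then have "?A = 0" "?B = 0" by (auto intro!: sum.neutral)
  then show ?thesis using True by simp
next
  case False
  have "T_poly_rec n v t \<tau> \<kappa> x = (1 / real (\<Sum>s=1..m. \<kappa> s)) *\<^sub>R (?A + ?B)"
    unfolding T_poly_rec.simps[of n v t \<tau> \<kappa> x] if_not_P[OF False] sum_slice_indices(3)[of "\<lambda>s. _ s *\<^sub>R (_ s * _ s)"] add_diff_cancel_left'
    by (rule arg_cong2[where f = scaleR, OF refl], rule arg_cong2[where f = "(+)"]; intro sum.cong refl) auto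
  then have "real (\<Sum>s=1..m. \<kappa> s) *\<^sub>R T_poly_rec n v t \<tau> \<kappa> x =
      real (\<Sum>s=1..m. \<kappa> s) *\<^sub>R ((1 / real (\<Sum>s=1..m. \<kappa> s)) *\<^sub>R (?A + ?B))" by (rule arg_cong)
  then show ?thesis using False by (simp del: of_nat_sum)
qed

lemma sum_lower:
  assumes "s \<in> {1..m}" "\<kappa> s \<noteq> 0"
  shows "(\<Sum>u=1..m. \<kappa> u) = Suc (\<Sum>u=1..m. (\<kappa>(s := \<kappa> s - 1)) u)"
  using sum_increment[of "{1..m}" s "\<kappa>(s := \<kappa> s - 1)"] assms by simp

lemma hom_poly_T_poly_rec:
  "hom_poly n (\<Sum>s=1..m. \<kappa> s) (\<lambda>x. T_poly_rec n v t \<tau> \<kappa> (comb x))"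
proof (induction "\<Sum>s=1..m. \<kappa> s" arbitrary: \<kappa>)
  case 0
  then have T: "(\<lambda>x. T_poly_rec n v t \<tau> \<kappa> (comb x)) = (\<lambda>x. 1)"
    by (intro ext) (subst T_poly_rec.simps, simp)
  show ?case unfolding 0[symmetric] T by (rule hom_poly.const)
next
  case (Suc k)
  have lower: "hom_poly n k (\<lambda>x. T_poly_rec n v t \<tau> (\<kappa>(s := \<kappa> s - 1)) (comb x))"
    if "s \<in> {1..m}" "\<kappa> s \<noteq> 0" for s
    using Suc.hyps(1)[of "\<kappa>(s := \<kappa> s - 1)"] Suc.hyps(2) sum_lower[of s \<kappa>, OF that] by simp
  have v_term: "hom_poly n (Suc k) (\<lambda>x. real (\<kappa> s) *\<^sub>R (T_poly_rec n v t \<tau> (\<kappa>(s := \<kappa> s - 1)) (comb x) *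
       (of_real (coord n v (comb x) s) - (c * coord n v (comb x) 0) *\<^sub>R v s)))"
    if s: "s \<in> {1..t 0}" for s c
  proof (cases "\<kappa> s = 0")
    case False
    note l = lower[OF _ False]
    have "hom_poly n (Suc k) (\<lambda>x. real (\<kappa> s) *\<^sub>R (x s *\<^sub>R T_poly_rec n v t \<tau> (\<kappa>(s := \<kappa> s - 1)) (comb x) +
       x 0 *\<^sub>R (T_poly_rec n v t \<tau> (\<kappa>(s := \<kappa> s - 1)) (comb x) * (- c *\<^sub>R v s))))"
      using s t_0_le_n
      by (intro hom_poly_linear[OF _ linear_scaleR] hom_poly.add hom_poly.mult
        hom_poly_linear[OF _ linear_mult_const(1)] l) auto
    then show ?thesis
      using s t_0_le_n by (simp add: coord_comb of_real_def algebra_simps)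
  qed (simp add: hom_poly.zero)
  have block_term: "hom_poly n (Suc k) (\<lambda>x. c *\<^sub>R
       (T_poly_rec n v t \<tau> (\<kappa>(t 0 + h := \<kappa> (t 0 + h) - 1)) (comb x) *
       (of_real (coord n v (comb x) 0) + d *\<^sub>R block_part n v t (comb x) h)))"
    if h: "h \<in> {1..\<tau>}" and nz: "\<kappa> (t 0 + h) \<noteq> 0" for h c d
  proof -
    note l = lower[OF _ nz]
    let ?T = "\<lambda>x. T_poly_rec n v t \<tau> (\<kappa>(t 0 + h := \<kappa> (t 0 + h) - 1)) (comb x)"
    have "hom_poly n (Suc k) (\<lambda>x. c *\<^sub>R (x 0 *\<^sub>R ?T x + (\<Sum>l\<in>block h. x l *\<^sub>R (?T x * d *\<^sub>R v l))))"
      using h block_subset_0_n[OF h]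
      by (intro hom_poly_linear[OF _ linear_scaleR] hom_poly.add hom_poly.mult hom_poly_sum
        hom_poly_linear[OF _ linear_mult_const(1)] l) auto
    then show ?thesis
      using h by (simp add: coord_comb block_part_comb of_real_def distrib_left sum_distrib_left scaleR_sum_right
        mult.commute)
  qed
  have "hom_poly n (Suc k) (\<lambda>x. real (\<Sum>s=1..m. \<kappa> s) *\<^sub>R T_poly_rec n v t \<tau> \<kappa> (comb x))"
    unfolding T_poly_rec_scaled
  proof (intro hom_poly.add hom_poly_sum v_term)
    fix h assume h: "h \<in> {1..\<tau>}"
    show "hom_poly n (Suc k) (\<lambda>x. ((-1) ^ (\<Sum>u=t 0 + h + 1..m. \<kappa> u) * real (\<kappa> (t 0 + h))) *\<^sub>R
       (T_poly_rec n v t \<tau> (\<kappa>(t 0 + h := \<kappa> (t 0 + h) - 1)) (comb x) *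
       (of_real (coord n v (comb x) 0) +
         (-1) ^ ((\<Sum>u=t 0 + 1..m. \<kappa> u) - \<kappa> (t 0 + h)) *\<^sub>R block_part n v t (comb x) h)))"
    proof (cases "\<kappa> (t 0 + h) = 0")
      case True
      then show ?thesis by (simp add: hom_poly.zero)
    next
      case False
      then show ?thesis by (rule block_term[OF h])
    qed
  qed
  then have "hom_poly n (Suc k) (\<lambda>x. real (Suc k) *\<^sub>R T_poly_rec n v t \<tau> \<kappa> (comb x))"
    by (simp only: Suc.hyps(2))
  from hom_poly_linear[OF this linear_scaleR[of "1 / real (Suc k)"]]
  show ?case by (simp add: Suc.hyps(2)[symmetric] del: of_nat_Suc)
qed

lemma coord_slice:
  assumes "J \<in> torus" "s \<le> t 0"
  shows "coord n v (slice J x) s = x s"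
  using assms t_0_le_n by (simp add: slice_eq_comb coord_comb slice_coeff_def)

lemma block_part_slice:
  assumes "J \<in> torus" "h \<in> {1..\<tau>}"
  shows "block_part n v t (slice J x) h = x (t 0 + h) *\<^sub>R J h"
  using assms by (simp add: slice_eq_comb block_part_comb slice_coeff_block_sum)

text \<open>  Both sides satisfy the same recursion. In the terms with \<open>s \<le> t 0\<close>, the sign in the definition compensates
  for moving \<open>v s\<close> to the left of the product of units. In the terms with \<open>s = t 0 + h\<close>, one unit \<open>J h\<close> is split off
  that product, and \<open>(x s - x 0 * J h) * J h = x 0 + x s * J h\<close> turns the Fueter variable into the factor of the
  definition.\<close>

lemma T_poly_rec_slice:
  assumes J: "J \<in> torus"
  shows "T_poly_rec n v t \<tau> \<kappa> (slice J x) = real (multi_fact {1..m} \<kappa>) *\<^sub>R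
    (fueter (adapted_basis v t J) m (\<lambda>s. int (\<kappa> s)) x * unit_power J \<kappa>)"
proof (induction "\<Sum>s=1..m. \<kappa> s" arbitrary: \<kappa> rule: less_induct)
  case less
  let ?l = "\<lambda>s. int (\<kappa> s)" and ?w = "adapted_basis v t J"
  let ?M = "real (multi_fact {1..m} \<kappa>)"
  let ?F = "\<lambda>s. fueter ?w m (decr s ?l) x"
  have IH: "real (\<kappa> s) *\<^sub>R T_poly_rec n v t \<tau> (\<kappa>(s := \<kappa> s - 1)) (slice J x) =
      ?M *\<^sub>R (?F s * unit_power J (\<kappa>(s := \<kappa> s - 1)))"
    if "s \<in> {1..m}" "\<kappa> s \<noteq> 0" for s
  proof -
    have "T_poly_rec n v t \<tau> (\<kappa>(s := \<kappa> s - 1)) (slice J x) =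
      real (multi_fact {1..m} (\<kappa>(s := \<kappa> s - 1))) *\<^sub>R (?F s * unit_power J (\<kappa>(s := \<kappa> s - 1)))"
      unfolding decr_of_nat[of \<kappa> s, OF that(2)]
      by (rule less) (simp only: sum_lower[of s \<kappa>, OF that] lessI)
    moreover have "?M = real (\<kappa> s) * real (multi_fact {1..m} (\<kappa>(s := \<kappa> s - 1)))"
      using multi_fact_decrement[of "{1..m}" s \<kappa>] that by simp
    ultimately show ?thesis by (simp only: scaleR_scaleR)
  qed
  have F0: "?F s = 0" if "s \<in> {1..m}" "\<kappa> s = 0" for s
    using that by (intro fueter_negative_index) (auto simp: decr_def)
  have v_term: "real (\<kappa> s) *\<^sub>R (T_poly_rec n v t \<tau> (\<kappa>(s := \<kappa> s - 1)) (slice J x) *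
       (of_real (coord n v (slice J x) s) - ((-1) ^ (\<Sum>u=t 0 + 1..m. \<kappa> u) * coord n v (slice J x) 0) *\<^sub>R v s)) =
      ?M *\<^sub>R (?F s * (of_real (x s) - x 0 *\<^sub>R ?w s) * unit_power J \<kappa>)" (is "?L = ?R")
    if s: "s \<in> {1..t 0}" for s
  proof (cases "\<kappa> s = 0")
    case True
    then show ?thesis using F0[of s] s by simp
  next
    case False
    let ?sg = "(-1::real) ^ (\<Sum>u=t 0 + 1..m. \<kappa> u)"
    have U: "unit_power J (\<kappa>(s := \<kappa> s - 1)) = unit_power J \<kappa>"
      unfolding unit_power_def using s
      by (intro arg_cong[of _ _ prod_list] map_cong refl) (auto simp: One_nat_def)
    have "?L = (real (\<kappa> s) *\<^sub>R T_poly_rec n v t \<tau> (\<kappa>(s := \<kappa> s - 1)) (slice J x)) *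
       (of_real (x s) - (?sg * x 0) *\<^sub>R v s)"
      using s by (simp add: coord_slice[OF J])
    also have "\<dots> = ?M *\<^sub>R (?F s * (unit_power J \<kappa> * (of_real (x s) - (?sg * x 0) *\<^sub>R v s)))"
      using s by (subst IH) (auto simp: False U mult.assoc)
    also have "unit_power J \<kappa> * (of_real (x s) - (?sg * x 0) *\<^sub>R v s) =
        (of_real (x s) - x 0 *\<^sub>R ?w s) * unit_power J \<kappa>"
      using s unit_power_v[OF J s, of \<kappa>]
      by (simp add: of_real_def algebra_simps flip: power_add mult_2)
    finally show ?thesis unfolding mult.assoc .
  qed
  have block_term: "((-1) ^ (\<Sum>u=t 0 + h + 1..m. \<kappa> u) * real (\<kappa> (t 0 + h))) *\<^sub>R
       (T_poly_rec n v t \<tau> (\<kappa>(t 0 + h := \<kappa> (t 0 + h) - 1)) (slice J x) *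
       (of_real (coord n v (slice J x) 0) +
         (-1) ^ ((\<Sum>u=t 0 + 1..m. \<kappa> u) - \<kappa> (t 0 + h)) *\<^sub>R block_part n v t (slice J x) h)) =
      ?M *\<^sub>R (?F (t 0 + h) * (of_real (x (t 0 + h)) - x 0 *\<^sub>R ?w (t 0 + h)) * unit_power J \<kappa>)" (is "?L = ?R")
    if h: "h \<in> {1..\<tau>}" for h
  proof (cases "\<kappa> (t 0 + h) = 0")
    case True
    then show ?thesis using F0[of "t 0 + h"] h by simp
  next
    case False
    let ?s = "t 0 + h"
    let ?b = "(-1::real) ^ (\<Sum>u=t 0 + h + 1..m. \<kappa> u)" and ?a = "(-1::real) ^ ((\<Sum>u=t 0 + 1..m. \<kappa> u) - \<kappa> ?s)"
    let ?U = "unit_power J (\<kappa>(?s := \<kappa> ?s - 1))"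
    have "?L = ?b *\<^sub>R ((real (\<kappa> ?s) *\<^sub>R T_poly_rec n v t \<tau> (\<kappa>(?s := \<kappa> ?s - 1)) (slice J x)) *
       (of_real (x 0) + ?a *\<^sub>R (x ?s *\<^sub>R J h)))"
      using h by (simp add: coord_slice[OF J] block_part_slice[OF J])
    also have "\<dots> = ?M *\<^sub>R (?F ?s * (?b *\<^sub>R (?U * (of_real (x 0) + ?a *\<^sub>R (x ?s *\<^sub>R J h)))))"
      using h by (subst IH) (auto simp: False mult.assoc)
    also have "?b *\<^sub>R (?U * (of_real (x 0) + ?a *\<^sub>R (x ?s *\<^sub>R J h))) =
        ?b *\<^sub>R (x 0 *\<^sub>R ?U + x ?s *\<^sub>R (?a *\<^sub>R (?U * J h)))"
      by (simp add: of_real_def algebra_simps)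
    also have "\<dots> = ?b *\<^sub>R (x 0 *\<^sub>R ?U + x ?s *\<^sub>R (J h * ?U))"
      by (simp only: unit_power_component[OF J h])
    also have "x 0 *\<^sub>R ?U = - (x 0 *\<^sub>R (J h * (J h * ?U)))"
      using torus_square[OF J h] by (simp flip: mult.assoc)
    also have "?b *\<^sub>R (- (x 0 *\<^sub>R (J h * (J h * ?U))) + x ?s *\<^sub>R (J h * ?U)) =
        (of_real (x ?s) - x 0 *\<^sub>R J h) * (?b *\<^sub>R (J h * ?U))"
      by (simp add: of_real_def algebra_simps)
    also have "?b *\<^sub>R (J h * ?U) = unit_power J \<kappa>"
      by (rule unit_power_split[where \<kappa> = \<kappa>, OF J h False, symmetric])
    finally have "?L = ?M *\<^sub>R (?F ?s * ((of_real (x ?s) - x 0 *\<^sub>R J h) * unit_power J \<kappa>))" .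
    moreover have "?w ?s = J h" using h by simp
    ultimately show ?thesis by (simp only: mult.assoc)
  qed
  show ?case
  proof (cases "(\<Sum>s=1..m. \<kappa> s) = 0")
    case True
    then have z: "\<kappa> s = 0" if "s \<in> {1..m}" for s using that by simp
    have "unit_power J \<kappa> = prod_list (map (\<lambda>i. 1) (rev [1..<Suc \<tau>]))"
      unfolding unit_power_def
      by (intro arg_cong[of _ _ prod_list] map_cong refl) (auto simp: z)
    then have "unit_power J \<kappa> = 1" by (simp add: map_replicate_const del: upt_Suc)
    moreover have "T_poly_rec n v t \<tau> \<kappa> (slice J x) = 1"
      using True by (subst T_poly_rec.simps) simp
    moreover have "multi_fact {1..m} \<kappa> = 1" by (simp add: multi_fact_def z)
    moreover have "fueter ?w m ?l x = 1"
      by (subst fueter_degree_0) (simp_all add: z)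
    ultimately show ?thesis by simp
  next
    case False
    have "real (\<Sum>s=1..m. \<kappa> s) *\<^sub>R T_poly_rec n v t \<tau> \<kappa> (slice J x) =
      (\<Sum>s=1..m. ?M *\<^sub>R (?F s * (of_real (x s) - x 0 *\<^sub>R ?w s) * unit_power J \<kappa>))"
      unfolding T_poly_rec_scaled unfolding sum_slice_indices(2)
      by (intro arg_cong2[where f = "(+)"] sum.cong refl v_term block_term)
    also have "\<dots> = ?M *\<^sub>R ((\<Sum>s=1..m. ?F s * (of_real (x s) - x 0 *\<^sub>R ?w s)) * unit_power J \<kappa>)"
      by (simp only: scaleR_sum_right sum_distrib_right)
    also have "(\<Sum>s=1..m. ?F s * (of_real (x s) - x 0 *\<^sub>R ?w s)) = real (\<Sum>s=1..m. \<kappa> s) *\<^sub>R fueter ?w m ?l x"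
      using fueter_rec[of ?l m ?w x] by simp
    also have "?M *\<^sub>R (real (\<Sum>s=1..m. \<kappa> s) *\<^sub>R fueter ?w m ?l x * unit_power J \<kappa>) =
      real (\<Sum>s=1..m. \<kappa> s) *\<^sub>R (?M *\<^sub>R (fueter ?w m ?l x * unit_power J \<kappa>))"
      by (simp only: mult_scaleR_left scaleR_left_commute)
    finally have "real (\<Sum>s=1..m. \<kappa> s) *\<^sub>R T_poly_rec n v t \<tau> \<kappa> (slice J x) =
      real (\<Sum>s=1..m. \<kappa> s) *\<^sub>R (?M *\<^sub>R (fueter ?w m ?l x * unit_power J \<kappa>))" .
    moreover have "real (\<Sum>s=1..m. \<kappa> s) \<noteq> 0" using False by (simp del: of_nat_sum)
    ultimately show ?thesis by (rule scaleR_left_imp_eq[rotated])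
  qed
qed

end

section \<open>The identity principle\<close>

context hypercomplex_setting
begin

abbreviation "degree_indices k \<equiv> multi_indices_of_degree {1..m} k"

lemma U_module_extensional: "f \<in> U_module B n v t \<tau> k \<Longrightarrow> f \<in> extensional V"
  by (simp add: U_module_def T_regular_def flip: V_eq)

text \<open>  A point of the slice of \<open>J'\<close> whose coordinate along \<open>J' h\<close> is zero also lies in the slice of \<open>J\<close>. So \<open>f\<close>
  vanishes on a coordinate hyperplane of the slice of \<open>J'\<close>, on which it is monogenic.\<close>

lemma eq_0_on_adjacent_slice:
  assumes f: "f \<in> U_module B n v t \<tau> k"
    and J: "J \<in> torus" "J' \<in> torus" and h: "h \<in> {1..\<tau>}"
    and adjacent: "\<And>i. i \<in> {1..\<tau>} \<Longrightarrow> i \<noteq> h \<Longrightarrow> J' i = J i"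
    and zero: "\<And>x. f (slice J x) = 0"
  shows "f (slice J' x) = 0"
proof (rule monogenic_eq_0_if_0_on_hyperplane[OF U_module_slice[OF f J(2)]])
  show "t 0 + h \<le> m" using h by simp
  show "- J' h * adapted_basis v t J' (t 0 + h) = 1"
    using torus_square[OF J(2) h] h by simp
  fix x :: "nat \<Rightarrow> real" assume x: "x (t 0 + h) = 0"
  have "slice J' x = slice J x"
    unfolding slice_eq
  proof (intro arg_cong2[where f = "(+)"] sum.cong refl)
    fix i assume "i \<in> {1..\<tau>}"
    then show "x (t 0 + i) *\<^sub>R J' i = x (t 0 + i) *\<^sub>R J i"
      using adjacent[of i] x by (cases "i = h") auto
  qed
  then show "f (slice J' x) = 0" by (simp add: zero)
qed

lemma eq_0_on_all_slices:
  assumes f: "f \<in> U_module B n v t \<tau> k" and J: "J0 \<in> torus" "J \<in> torus"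
    and zero: "\<And>x. f (slice J0 x) = 0"
  shows "f (slice J x) = 0"
proof -
  \<comment> \<open>\<open>K j\<close> interpolates between \<open>J0\<close> and \<open>J\<close>; consecutive members differ in one component.\<close>
  define K where "K j = (\<lambda>h. if h \<in> {1..j} then J h else J0 h)" for j
  have K: "K j \<in> torus" if "j \<le> \<tau>" for j
    unfolding T_torus_def
  proof (rule PiE_I)
    fix h assume "h \<in> {1..\<tau>}"
    then show "K j h \<in> unit_sphere B v (t (h - 1) + 1) (t h)"
      using J by (simp add: K_def T_torus_def PiE_iff)
  next
    fix h assume h: "h \<notin> {1..\<tau>}"
    then have "h \<notin> {1..j}" using that by auto
    then show "K j h = undefined"
      using J(1) h by (simp add: K_def T_torus_def PiE_iff extensional_def del: atLeastAtMost_iff)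
  qed
  have "f (slice (K j) x) = 0" if "j \<le> \<tau>" for j x
    using that
  proof (induction j arbitrary: x)
    case 0
    have "K 0 = J0" by (simp add: K_def One_nat_def)
    then show ?case by (simp add: zero)
  next
    case (Suc j)
    show ?case
    proof (rule eq_0_on_adjacent_slice[OF f K K])
      show "Suc j \<in> {1..\<tau>}" using Suc.prems by (simp add: One_nat_def)
      show "f (slice (K j) x) = 0" for x using Suc by simp
      show "K (Suc j) i = K j i" if "i \<noteq> Suc j" for i
        using that by (auto simp: K_def)
    qed (use Suc.prems in simp_all)
  qed
  moreover have "slice (K \<tau>) x = slice J x"
    unfolding slice_eq by (intro arg_cong2[where f = "(+)"] sum.cong refl) (simp add: K_def)
  ultimately show ?thesis by (metis order_refl)
qed

text \<open>  The component \<open>J h\<close> is the normalized block of \<open>x\<close>; if the block is zero, any unit vector will do.\<close>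

lemma slices_cover_V:
  assumes "x \<in> V"
  obtains J y where "J \<in> torus" "x = slice J y"
proof -
  define X where "X = crd x"
  define r where "r h = sqrt (\<Sum>l\<in>block h. (X l)\<^sup>2)" for h
  define c where "c h l = (if r h = 0 then of_bool (l = t h) else X l / r h)" for h l
  define J where "J = (\<lambda>h\<in>{1..\<tau>}. \<Sum>l\<in>block h. c h l *\<^sub>R v l)"
  define y where "y s = (if s \<le> t 0 then X s else r (s - t 0))" for s
  have sq: "(r h)\<^sup>2 = (\<Sum>l\<in>block h. (X l)\<^sup>2)" for h
    unfolding r_def by (intro real_sqrt_pow2 sum_nonneg) simp
  have "(\<Sum>l\<in>block h. (c h l)\<^sup>2) = 1" if h: "h \<in> {1..\<tau>}" for h
  proof (cases "r h = 0")
    case True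
    then have "(\<Sum>l\<in>block h. (c h l)\<^sup>2) = (\<Sum>l\<in>block h. if l = t h then 1 else 0)"
      by (intro sum.cong refl) (simp add: c_def)
    also have "\<dots> = 1" using block_nonempty[OF h] by simp
    finally show ?thesis .
  next
    case False
    then have "(\<Sum>l\<in>block h. (c h l)\<^sup>2) = (r h)\<^sup>2 / (r h)\<^sup>2"
      unfolding sq[of h] sum_divide_distrib by (simp add: c_def power_divide sq)
    with False show ?thesis by simp
  qed
  then have J: "J \<in> torus"
    unfolding T_torus_def J_def by (intro restrict_PiE_iff[THEN iffD2] ballI unit_sphere_intro) auto
  have "r h * c h l = X l" if "l \<in> block h" for h l
  proof (cases "r h = 0")
    case True
    then have "(\<Sum>l\<in>block h. (X l)\<^sup>2) = 0" using sq[of h] by simp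
    then have "(X l)\<^sup>2 = 0" using that by (subst (asm) sum_nonneg_eq_0_iff) auto
    then show ?thesis using True by simp
  qed (simp add: c_def)
  then have "r h *\<^sub>R J h = (\<Sum>l\<in>block h. X l *\<^sub>R v l)" if "h \<in> {1..\<tau>}" for h
    using that by (simp add: J_def scaleR_sum_right)
  then have "slice J y = comb X"
    unfolding slice_eq comb_def sum_comb_indices
    by (intro arg_cong2[where f = "(+)"] sum.cong refl) (auto simp: y_def)
  then have "x = slice J y" using comb_crd[OF assms] by (simp add: X_def)
  with J show thesis by (rule that)
qed

lemma eq_0_if_0_on_slice:
  assumes "f \<in> U_module B n v t \<tau> k" "J \<in> torus" "\<And>x. f (slice J x) = 0" "x \<in> V"
  shows "f x = 0"
proof -
  from slices_cover_V[OF assms(4)] obtain J' y where "J' \<in> torus" "x = slice J' y" .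
  then show ?thesis using eq_0_on_all_slices[OF assms(1,2) _ assms(3)] by simp
qed

section \<open>The expansion\<close>

lemma T_poly_combination_slice:
  assumes "J \<in> torus"
  shows "(\<Sum>\<mu>\<in>I. T_poly n v t \<tau> \<mu> (slice J x) * c \<mu>) =
    (\<Sum>\<mu>\<in>I. fueter (adapted_basis v t J) m (\<lambda>s. int (\<mu> s)) x *
       (real (multi_fact {1..m} \<mu>) *\<^sub>R (unit_power J \<mu> * c \<mu>)))"
  using slice_in_V[OF assms]
  by (intro sum.cong refl) (simp add: T_poly_def T_poly_rec_slice[OF assms] mult.assoc flip: V_eq)

lemma adapted_basis_0: "adapted_basis v t J 0 = 1"
  by (simp add: v_0)

lemma degree_indices_sum: "\<mu> \<in> degree_indices k \<Longrightarrow> (\<Sum>s=1..m. \<mu> s) = k"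
  by (simp add: multi_indices_of_degree_def)

lemma hom_poly_fueter_degree_indices:
  assumes "\<mu> \<in> degree_indices k"
  shows "hom_poly m k (fueter w m (\<lambda>s. int (\<mu> s)))"
  using degree_indices_sum[OF assms] by (intro hom_poly_fueter) (simp flip: of_nat_sum)

lemma T_poly_combination_in_U_module:
  "(\<lambda>x\<in>V. \<Sum>\<mu>\<in>degree_indices k. T_poly n v t \<tau> \<mu> x * c \<mu>) \<in> U_module B n v t \<tau> k"
proof (rule U_module_intro)
  have "hom_poly n k (\<lambda>x. T_poly_rec n v t \<tau> \<mu> (comb x))" if "\<mu> \<in> degree_indices k" for \<mu>
    using hom_poly_T_poly_rec[of \<mu>] by (simp only: degree_indices_sum[OF that])
  then have "hom_poly n k (\<lambda>x. \<Sum>\<mu>\<in>degree_indices k. T_poly_rec n v t \<tau> \<mu> (comb x) * c \<mu>)"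
    by (rule hom_poly_combination)
  then show "hom_poly n k (\<lambda>x. (\<lambda>x\<in>V. \<Sum>\<mu>\<in>degree_indices k. T_poly n v t \<tau> \<mu> x * c \<mu>) (comb x))"
    by (simp add: comb_in_V T_poly_def flip: V_eq)
next
  fix J assume J: "J \<in> torus"
  have eq: "(\<lambda>x. (\<lambda>x\<in>V. \<Sum>\<mu>\<in>degree_indices k. T_poly n v t \<tau> \<mu> x * c \<mu>) (slice J x)) =
    (\<lambda>x. \<Sum>\<mu>\<in>degree_indices k. fueter (adapted_basis v t J) m (\<lambda>s. int (\<mu> s)) x *
       (real (multi_fact {1..m} \<mu>) *\<^sub>R (unit_power J \<mu> * c \<mu>)))"
    by (simp add: slice_in_V[OF J] T_poly_combination_slice[OF J])
  show "hom_poly m k (\<lambda>x. (\<lambda>x\<in>V. \<Sum>\<mu>\<in>degree_indices k. T_poly n v t \<tau> \<mu> x * c \<mu>) (slice J x))"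
    unfolding eq by (intro hom_poly_combination hom_poly_fueter_degree_indices)
  show "monogenic (adapted_basis v t J) m
      (\<lambda>x. (\<lambda>x\<in>V. \<Sum>\<mu>\<in>degree_indices k. T_poly n v t \<tau> \<mu> x * c \<mu>) (slice J x))"
    unfolding eq
    by (rule monogenic_combination) (rule hom_poly_fueter_degree_indices monogenic_fueter adapted_basis_0 | assumption)+
qed simp

lemma U_module_diff:
  assumes "f \<in> U_module B n v t \<tau> k" "g \<in> U_module B n v t \<tau> k"
  shows "(\<lambda>x\<in>V. f x - g x) \<in> U_module B n v t \<tau> k"
proof (rule U_module_intro)
  show "hom_poly n k (\<lambda>x. (\<lambda>x\<in>V. f x - g x) (comb x))"
    using hom_poly_diff[OF U_module_hom_poly U_module_hom_poly, OF assms] by (simp add: comb_in_V)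
next
  fix J assume J: "J \<in> torus"
  show "hom_poly m k (\<lambda>x. (\<lambda>x\<in>V. f x - g x) (slice J x))"
    using hom_poly_diff[OF U_module_slice(1)[OF assms(1) J] U_module_slice(1)[OF assms(2) J]]
    by (simp add: slice_in_V[OF J])
  show "monogenic (adapted_basis v t J) m (\<lambda>x. (\<lambda>x\<in>V. f x - g x) (slice J x))"
    using monogenic_diff[OF U_module_slice(1)[OF assms(1) J] U_module_slice(1)[OF assms(2) J]
      U_module_slice(2)[OF assms(1) J] U_module_slice(2)[OF assms(2) J]]
    by (simp add: slice_in_V[OF J])
qed simp

text \<open>  The coefficients are determined on a single slice; the identity principle extends the expansion to \<open>V\<close>.\<close>

lemma U_module_expansion:
  assumes "P \<in> U_module B n v t \<tau> k"
  shows "\<exists>c. \<forall>x\<in>V. P x = (\<Sum>\<mu>\<in>degree_indices k. T_poly n v t \<tau> \<mu> x * c \<mu>)"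
proof -
  obtain J where J: "J \<in> torus" using torus_nonempty by blast
  let ?F = "\<lambda>\<mu>. fueter (adapted_basis v t J) m (\<lambda>s. int (\<mu> s))"
  from fueter_expansion[OF U_module_slice[OF assms J] adapted_basis_0]
  obtain d where d: "\<forall>x. P (slice J x) = (\<Sum>\<mu>\<in>degree_indices k. ?F \<mu> x * d \<mu>)"
    by (elim exE)
  define c where "c \<mu> = (1 / real (multi_fact {1..m} \<mu>)) *\<^sub>R (mult_inverse (unit_power J \<mu>) * d \<mu>)" for \<mu>
  define Q where "Q = (\<lambda>x\<in>V. \<Sum>\<mu>\<in>degree_indices k. T_poly n v t \<tau> \<mu> x * c \<mu>)"
  have "real (multi_fact {1..m} \<mu>) *\<^sub>R (unit_power J \<mu> * c \<mu>) = d \<mu>" for \<mu>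
    using unit_power_inverse(2)[OF J, of \<mu>] multi_fact_pos[of "{1..m}" \<mu>]
    by (simp add: c_def flip: mult.assoc)
  then have PQ: "P (slice J x) = Q (slice J x)" for x
    by (simp add: Q_def slice_in_V[OF J] T_poly_combination_slice[OF J] d)
  have Q: "Q \<in> U_module B n v t \<tau> k"
    unfolding Q_def by (rule T_poly_combination_in_U_module)
  have "P x = Q x" if "x \<in> V" for x
    using eq_0_if_0_on_slice[OF U_module_diff[OF assms Q] J _ that] that
    by (simp add: slice_in_V[OF J] PQ)
  then show ?thesis by (intro exI[of _ c] ballI) (simp add: Q_def)
qed

section \<open>Adapted derivatives at the origin\<close>

lemma partial_deriv_power_slice:
  assumes "s \<le> m" "\<And>x. f (slice J x) = F x"
  shows "(partial_deriv (adapted_basis v t J s) ^^ j) f (slice J x) = (pd s ^^ j) F x"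
proof (induction j arbitrary: x)
  case (Suc j)
  then show ?case by (simp add: partial_deriv_slice[OF assms(1)])
qed (simp add: assms)

lemma partial_deriv_multi_slice:
  assumes "set xs \<subseteq> {0..m}"
  shows "foldr (\<lambda>s. partial_deriv (adapted_basis v t J s) ^^ \<kappa> s) xs f (slice J x) =
    foldr (\<lambda>s. pd s ^^ \<kappa> s) xs (\<lambda>x. f (slice J x)) x"
  using assms
proof (induction xs arbitrary: x)
  case (Cons s xs)
  then show ?case by (simp add: partial_deriv_power_slice)
qed simp

text \<open>  On every slice the adapted derivative is the same value: the derivatives of the Fueter polynomials leave
  the product of units times the coefficient, and the prefactor cancels that product. Hence the description
  by \<open>THE\<close> is proper at the origin, which lies in all slices.\<close>

lemma adapted_deriv_combination:
  assumes I: "finite I" "I \<subseteq> multi_indices {1..m}" and \<kappa>: "\<kappa> \<in> multi_indices {1..m}"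
    and f: "\<And>x. x \<in> V \<Longrightarrow> f x = (\<Sum>\<mu>\<in>I. T_poly n v t \<tau> \<mu> x * c \<mu>)"
  shows "adapted_deriv B v t \<tau> V (\<kappa>(0 := 0)) f 0 =
    (if \<kappa> \<in> I then real (multi_fact {1..m} \<kappa>) *\<^sub>R c \<kappa> else 0)" (is "_ = ?y")
proof -
  have \<kappa>0: "\<kappa>(0 := 0) = \<kappa>" using \<kappa> by (auto simp: multi_indices_def)
  have zero: "slice J (\<lambda>_. 0) = 0" for J by (simp add: slice_def)
  have deriv: "adapted_deriv_J v t \<tau> J \<kappa> f 0 = ?y" if J: "J \<in> torus" for J
  proof -
    have "adapted_deriv_J v t \<tau> J \<kappa> f 0 = mult_inverse (unit_power J \<kappa>) *
        foldr (\<lambda>s. partial_deriv (adapted_basis v t J s) ^^ \<kappa> s) [0..<Suc m] f (slice J (\<lambda>_. 0))"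
      unfolding adapted_deriv_J_def unit_power_def zero ..
    also have "foldr (\<lambda>s. partial_deriv (adapted_basis v t J s) ^^ \<kappa> s) [0..<Suc m] f (slice J (\<lambda>_. 0)) =
        foldr (\<lambda>s. pd s ^^ \<kappa> s) [0..<Suc m] (\<lambda>x. f (slice J x)) (\<lambda>_. 0)"
      by (rule partial_deriv_multi_slice) auto
    also have "(\<lambda>x. f (slice J x)) = (\<lambda>x. \<Sum>\<mu>\<in>I. fueter (adapted_basis v t J) m (\<lambda>s. int (\<mu> s)) x *
       (real (multi_fact {1..m} \<mu>) *\<^sub>R (unit_power J \<mu> * c \<mu>)))"
      by (simp add: f slice_in_V[OF J] T_poly_combination_slice[OF J])
    also have "foldr (\<lambda>s. pd s ^^ \<kappa> s) [0..<Suc m] \<dots> (\<lambda>_. 0) =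
       (if \<kappa> \<in> I then real (multi_fact {1..m} \<kappa>) *\<^sub>R (unit_power J \<kappa> * c \<kappa>) else 0)"
      by (rule pd_multi_fueter_combination_at_0[OF I \<kappa>])
    finally show ?thesis
      using unit_power_inverse(1)[OF J, of \<kappa>] by (simp flip: mult.assoc)
  qed
  have mem: "0 \<in> V \<inter> adapted_space v t \<tau> J" if "J \<in> torus" for J
    unfolding V_inter_adapted_space[OF that] by (rule range_eqI[of _ _ "\<lambda>_. 0"]) (simp add: zero)
  obtain J where J: "J \<in> torus" using torus_nonempty by blast
  have "(THE y. \<forall>J\<in>torus. 0 \<in> V \<inter> adapted_space v t \<tau> J \<longrightarrow> y = adapted_deriv_J v t \<tau> J \<kappa> f 0) = ?y"
  proof (rule the_equality)
    show "\<forall>J\<in>torus. 0 \<in> V \<inter> adapted_space v t \<tau> J \<longrightarrow> ?y = adapted_deriv_J v t \<tau> J \<kappa> f 0"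
      by (intro ballI impI) (simp only: deriv)
  next
    fix y assume "\<forall>J\<in>torus. 0 \<in> V \<inter> adapted_space v t \<tau> J \<longrightarrow> y = adapted_deriv_J v t \<tau> J \<kappa> f 0"
    from bspec[OF this J] mem[OF J] have "y = adapted_deriv_J v t \<tau> J \<kappa> f 0" by (rule mp)
    then show "y = ?y" by (simp only: deriv[OF J])
  qed
  then show ?thesis
    using mem[OF J] by (simp only: adapted_deriv_def \<kappa>0 restrict_apply' IntD1)
qed

lemma finite_degree_indices: "finite (degree_indices k)"
  and degree_indices_subset: "degree_indices k \<subseteq> multi_indices {1..m}"
  by (rule finite_multi_indices_of_degree) (auto simp: multi_indices_of_degree_def)

lemma taylor_expansion:
  assumes "P \<in> U_module B n v t \<tau> k" "x \<in> V"
  shows "P x = (\<Sum>\<kappa>\<in>degree_indices k. T_poly n v t \<tau> \<kappa> x *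
    ((1 / real (multi_fact {1..m} \<kappa>)) *\<^sub>R adapted_deriv B v t \<tau> V (\<kappa>(0 := 0)) P 0))"
proof -
  from U_module_expansion[OF assms(1)]
  obtain c where "\<forall>x\<in>V. P x = (\<Sum>\<mu>\<in>degree_indices k. T_poly n v t \<tau> \<mu> x * c \<mu>)"
    by (elim exE)
  then have c: "P x = (\<Sum>\<mu>\<in>degree_indices k. T_poly n v t \<tau> \<mu> x * c \<mu>)" if "x \<in> V" for x
    using that by (rule bspec)
  show ?thesis
    unfolding c[OF assms(2)]
  proof (rule sum.cong[OF refl])
    fix \<kappa> assume \<kappa>: "\<kappa> \<in> degree_indices k"
    have "adapted_deriv B v t \<tau> V (\<kappa>(0 := 0)) P 0 = real (multi_fact {1..m} \<kappa>) *\<^sub>R c \<kappa>"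
      using adapted_deriv_combination[OF finite_degree_indices degree_indices_subset _ c] \<kappa> degree_indices_subset
      by (auto simp: subset_iff)
    then show "T_poly n v t \<tau> \<kappa> x * c \<kappa> = T_poly n v t \<tau> \<kappa> x *
      ((1 / real (multi_fact {1..m} \<kappa>)) *\<^sub>R adapted_deriv B v t \<tau> V (\<kappa>(0 := 0)) P 0)"
      using multi_fact_pos[of "{1..m}" \<kappa>] by simp
  qed
qed

lemma T_poly_basis:
  "right_module_basis V (degree_indices k) (T_poly n v t \<tau>) (U_module B n v t \<tau> k)"
  unfolding right_module_basis_def
proof (intro conjI ballI allI impI finite_degree_indices)
  show "T_poly n v t \<tau> \<kappa> \<in> extensional V" for \<kappa>
    unfolding T_poly_def V_eq by (rule restrict_extensional)
  show "U_module B n v t \<tau> k = range (\<lambda>c. \<lambda>x\<in>V. \<Sum>\<kappa>\<in>degree_indices k. T_poly n v t \<tau> \<kappa> x * c \<kappa>)"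
  proof
    show "U_module B n v t \<tau> k \<subseteq> range (\<lambda>c. \<lambda>x\<in>V. \<Sum>\<kappa>\<in>degree_indices k. T_poly n v t \<tau> \<kappa> x * c \<kappa>)"
    proof
      fix P assume P: "P \<in> U_module B n v t \<tau> k"
      from U_module_expansion[OF P]
      obtain c where "\<forall>x\<in>V. P x = (\<Sum>\<mu>\<in>degree_indices k. T_poly n v t \<tau> \<mu> x * c \<mu>)"
        by (elim exE)
      then have "P = (\<lambda>x\<in>V. \<Sum>\<kappa>\<in>degree_indices k. T_poly n v t \<tau> \<kappa> x * c \<kappa>)"
        using U_module_extensional[OF P] by (intro extensionalityI[of _ V]) simp_all
      then show "P \<in> range (\<lambda>c. \<lambda>x\<in>V. \<Sum>\<kappa>\<in>degree_indices k. T_poly n v t \<tau> \<kappa> x * c \<kappa>)"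
        by (intro range_eqI[of _ _ c])
    qed
    show "range (\<lambda>c. \<lambda>x\<in>V. \<Sum>\<kappa>\<in>degree_indices k. T_poly n v t \<tau> \<kappa> x * c \<kappa>) \<subseteq> U_module B n v t \<tau> k"
      by (rule image_subsetI) (rule T_poly_combination_in_U_module)
  qed
  fix c \<kappa> assume zero: "\<forall>x\<in>V. (\<Sum>\<kappa>\<in>degree_indices k. T_poly n v t \<tau> \<kappa> x * c \<kappa>) = 0"
    and \<kappa>: "\<kappa> \<in> degree_indices k"
  have \<kappa>': "\<kappa> \<in> multi_indices {1..m}" using \<kappa> degree_indices_subset by blast
  have "real (multi_fact {1..m} \<kappa>) *\<^sub>R c \<kappa> = adapted_deriv B v t \<tau> V (\<kappa>(0 := 0)) (\<lambda>_. 0) 0"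
    using adapted_deriv_combination[where I = "degree_indices k" and f = "\<lambda>_. 0" and c = c,
        OF finite_degree_indices degree_indices_subset \<kappa>'] zero \<kappa> by simp
  also have "\<dots> = 0"
    using adapted_deriv_combination[OF finite.emptyI empty_subsetI \<kappa>', where f = "\<lambda>_. 0"] by simp
  finally show "c \<kappa> = 0" using multi_fact_pos[of "{1..m}" \<kappa>] by simp
qed

lemma adapted_deriv_T_poly:
  assumes "\<kappa> \<in> multi_indices {1..m}" "\<kappa>' \<in> multi_indices {1..m}"
  shows "adapted_deriv B v t \<tau> V (\<kappa>(0 := 0)) (T_poly n v t \<tau> \<kappa>') 0 =
    (if \<kappa> = \<kappa>' then of_nat (multi_fact {1..m} \<kappa>) else 0)"
  using adapted_deriv_combination[of "{\<kappa>'}" \<kappa> "T_poly n v t \<tau> \<kappa>'" "\<lambda>_. 1"] assms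
  by (simp add: scaleR_conv_of_real)

end

theorem theorem5p14:
  fixes cj :: "'a::{real_algebra_1, euclidean_space} \<Rightarrow> 'a"
    and V B :: "'a set" and v :: "nat \<Rightarrow> 'a" and t :: "nat \<Rightarrow> nat" and n \<tau> k :: nat
  assumes "star_involution cj"
    and "imag_units cj \<noteq> {}"
    and "hypercomplex_subspace cj V"
    and "hypercomplex_basis cj V n v"
    and "completes_basis B n v"
    and "step_list n \<tau> t"
  shows "right_module_basis V (multi_indices_of_degree {1..t 0 + \<tau>} k) (T_poly n v t \<tau>)
           (U_module B n v t \<tau> k) \<and>
         (\<forall>P\<in>U_module B n v t \<tau> k. \<forall>x\<in>V.
           P x = (\<Sum>\<kappa>\<in>multi_indices_of_degree {1..t 0 + \<tau>} k.
             T_poly n v t \<tau> \<kappa> x *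
             ((1 / real (multi_fact {1..t 0 + \<tau>} \<kappa>)) *\<^sub>R
               adapted_deriv B v t \<tau> V (\<kappa>(0 := 0)) P 0))) \<and>
         (\<forall>\<kappa>\<in>multi_indices {1..t 0 + \<tau>}.
           adapted_deriv B v t \<tau> V (\<kappa>(0 := 0)) (T_poly n v t \<tau> \<kappa>) 0 =
             of_nat (multi_fact {1..t 0 + \<tau>} \<kappa>)) \<and>
         (\<forall>\<kappa>\<in>multi_indices {1..t 0 + \<tau>}. \<forall>\<kappa>'\<in>multi_indices {1..t 0 + \<tau>}. \<kappa> \<noteq> \<kappa>' \<longrightarrow>
           adapted_deriv B v t \<tau> V (\<kappa>(0 := 0)) (T_poly n v t \<tau> \<kappa>') 0 = 0)"
proof -
  interpret hypercomplex_setting cj V B v t n \<tau>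
    using assms(4-6) by (rule hypercomplex_setting.intro)
  show ?thesis
    by (intro conjI ballI impI T_poly_basis taylor_expansion) (simp_all only: adapted_deriv_T_poly simp_thms if_True if_False)
qed

end
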